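(* Let $G_{\mathrm{icosa}} \subset \mathrm{SU}(2)$ be the binary icosahedral group (of order $120$). Let $X \subset \mathbb{CP}^1$ be a finite set and for each $x\in X$ let $\lambda_x : x \to \Gamma^2(T_{2,1})$ be a linear map. Suppose that the trace of $\Psi_{(X,\lambda)}$, regarded as a linear endomorphism of $H$ (via $\Gamma^2(T_{2,1})\subset H$), equals $2$. Let \[ \Psi_Y(s) := \frac{1}{120}\sum_{g\in G_{\mathrm{icosa}}}\sum_{x\in X}(g\cdot\lambda_x)\bigl(e_{gx}(s)\bigr) \qquad (s\in H), \] which is $\Psi_{(Y,\lambda_Y)}$ for $(Y,\lambda_Y) = \frac{1}{120}\,G_{\mathrm{icosa}}\cdot(X,\lambda)$. Then $(Y,\lambda_Y)$ is a $\tau$-design, i.e. $\Psi_Y = \tau$; equivalently, \[ \Psi_Y\big|_{\Gamma^{2k}(T_{2,1})} = \begin{cases}\mathrm{id} & (k=1),\\ 0 & (k=2,3,4,5).\end{cases} \]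
   Context: Let $T_{2,1} = \{(l,v) \in \mathbb{CP}^1 \times \mathbb{C}^2 \mid v \in l\}$ be the tautological line bundle over $\mathbb{CP}^1$; the fiber over a point $l$ (a complex line in $\mathbb{C}^2$) is $l$ itself. $\mathrm{SU}(2)$ acts by $g\cdot(l,v) = (gl, gv)$. Let $\Gamma(T_{2,1})$ be the $L^2$-space of sections $s$ (so $s(l)\in l$), with action $(g\cdot s)(l) = g\, s(g^{-1}l)$. As an $\mathrm{SU}(2)$-representation, $\Gamma(T_{2,1}) = \bigoplus_{k\ge1}\Gamma^{2k}(T_{2,1})$ (Hilbert direct sum of pairwise non-isomorphic irreducibles), with $\Gamma^{2k}(T_{2,1}) \cong S^{2k-1}(\mathbb{C}^2)$ of dimension $2k$. Put $H = \bigoplus_{k=1}^{5}\Gamma^{2k}(T_{2,1})$ and let $\tau : H \to \Gamma^2(T_{2,1})$ be the projection along $\bigoplus_{k=2}^5\Gamma^{2k}(T_{2,1})$. For $l\in\mathbb{CP}^1$, $e_l : H \to l$, $e_l(s) = s(l)$. For finite $X\subset\mathbb{CP}^1$ and linear maps $\lambda_x : x\to\Gamma^2(T_{2,1})$, $\Psi_{(X,\lambda)}(s) = \sum_{x\in X}\lambda_x(e_x(s))$. A pair $(X,\lambda)$ is a $\tau$-design if $\tau = \Psi_{(X,\lambda)}$ on $H$. For $g\in\mathrm{SU}(2)$, $g\cdot\lambda_x : gx\to\Gamma^2(T_{2,1})$ is $(g\cdot\lambda_x)(z) = g\cdot(\lambda_x(g^{-1}z))$. The normalized orbit sum $\frac{1}{|G|}G\cdot(X,\lambda)$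 is $(Y,\lambda_Y)$ with $Y=\{gx\}$ and $\lambda_{Y,y} = \frac{1}{|G|}\sum_{(g,x):\,gx=y} g\cdot\lambda_x$. The binary icosahedral group is $G_{\mathrm{icosa}} = \langle S,T,U\rangle\subset\mathrm{SU}(2)$ where, with $\varepsilon$ a primitive fifth root of unity, $S = \mathrm{diag}(\varepsilon^3,\varepsilon^2)$, $T = \frac{1}{\varepsilon^2-\varepsilon^3}\begin{pmatrix}\varepsilon+\varepsilon^4 & 1\\ 1 & -\varepsilon-\varepsilon^4\end{pmatrix}$, $U = \begin{pmatrix}0&1\\-1&0\end{pmatrix}$. *)

theory Defs
  imports
    "HOL-Analysis.Analysis"
    "HOL-Algebra.Generated_Groups"
    "HOL-Library.Function_Algebras"
begin

section \<open>The group SU(2) and the binary icosahedral group\<close>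

definition conj_transpose :: "complex^'n^'m \<Rightarrow> complex^'m^'n" where
  "conj_transpose A = (\<chi> i j. cnj (A $ j $ i))"

definition SU2 :: "(complex^2^2) set" where
  "SU2 = {g. conj_transpose g ** g = mat 1 \<and> g ** conj_transpose g = mat 1 \<and> det g = 1}"

definition SU2_group :: "(complex^2^2) monoid" where
  "SU2_group = \<lparr>carrier = SU2, mult = (**), one = mat 1\<rparr>"

definition primitive_root_of_unity :: "nat \<Rightarrow> complex \<Rightarrow> bool" where
  "primitive_root_of_unity n z \<longleftrightarrow> 0 < n \<and> z ^ n = 1 \<and> (\<forall>k. 0 < k \<and> k < n \<longrightarrow> z ^ k \<noteq> 1)"

definition icosa_S :: "complex \<Rightarrow> complex^2^2" where
  "icosa_S \<epsilon> = vector [vector [\<epsilon> ^ 3, 0], vector [0, \<epsilon> ^ 2]]"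

definition icosa_T :: "complex \<Rightarrow> complex^2^2" where
  "icosa_T \<epsilon> = (\<chi> i j. 1 / (\<epsilon> ^ 2 - \<epsilon> ^ 3) *
      (vector [vector [\<epsilon> + \<epsilon> ^ 4, 1], vector [1, - \<epsilon> - \<epsilon> ^ 4]] :: complex^2^2) $ i $ j)"

definition icosa_U :: "complex^2^2" where
  "icosa_U = vector [vector [0, 1], vector [- 1, 0]]"

definition G_icosa :: "complex \<Rightarrow> (complex^2^2) set" where
  "G_icosa \<epsilon> = generate SU2_group {icosa_S \<epsilon>, icosa_T \<epsilon>, icosa_U}"

section \<open>The complex projective line\<close>

definition CP1 :: "(complex^2) set set" where
  "CP1 = {l. vec.subspace l \<and> vec.dim l = 1}"

definition line_of :: "complex^2 \<Rightarrow> (complex^2) set" where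
  "line_of v = vec.span {v}"

definition act_line :: "complex^2^2 \<Rightarrow> (complex^2) set \<Rightarrow> (complex^2) set" where
  "act_line g l = (\<lambda>v. g *v v) ` l"

text \<open>The \<open>SU(2)\<close>-invariant measure on the projective line (unique up to a positive factor): the
  image of Lebesgue measure on the punctured unit ball of \<open>\<complex>\<^sup>2\<close>, which is invariant under unitary
  maps, under \<^term>\<open>line_of\<close>. The measurable sets are those of the quotient sigma-algebra.\<close>

definition punctured_ball :: "(complex^2) measure" where
  "punctured_ball = restrict_space lborel (ball 0 1 - {0})"

definition CP1_measure :: "(complex^2) set measure" where
  "CP1_measure = distr punctured_ball
     (sigma CP1 {A. A \<subseteq> CP1 \<and> line_of -` A \<inter> space punctured_ball \<in> sets punctured_ball})
     line_of"

section \<open>Sections of the tautological bundle\<close>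

text \<open>A section is a total function on sets of vectors; it is required to vanish at arguments that
  are not lines, so that sections are equal as functions iff they agree on \<^term>\<open>CP1\<close>.\<close>

type_synonym sect = "(complex^2) set \<Rightarrow> complex^2"

definition sect_scale :: "complex \<Rightarrow> sect \<Rightarrow> sect" where
  "sect_scale c s = (\<lambda>l. c *s s l)"

interpretation sect: vector_space sect_scale
  by unfold_locales
    (simp_all add: sect_scale_def fun_eq_iff vec.scale_right_distrib vec.scale_left_distrib)

definition sections :: "sect set" where
  "sections = {s. (\<forall>l\<in>CP1. s l \<in> l) \<and> (\<forall>l. l \<notin> CP1 \<longrightarrow> s l = 0)}"

definition L2_sections :: "sect set" where
  "L2_sections = {s \<in> sections. s \<in> borel_measurable CP1_measure \<and>
     integrable CP1_measure (\<lambda>l. (norm (s l))\<^sup>2)}"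

text \<open>Continuity for the quotient topology on the projective line.\<close>

definition continuous_sections :: "sect set" where
  "continuous_sections = {s \<in> sections. continuous_on (- {0}) (\<lambda>v. s (line_of v))}"

definition act_sect :: "complex^2^2 \<Rightarrow> sect \<Rightarrow> sect" where
  "act_sect g s = (\<lambda>l. g *v s (act_line (matrix_inv g) l))"

section \<open>Symmetric powers and isotypic components\<close>

definition linear_betw ::
  "(complex \<Rightarrow> 'a \<Rightarrow> 'a) \<Rightarrow> (complex \<Rightarrow> 'b \<Rightarrow> 'b) \<Rightarrow> 'a::ab_group_add set \<Rightarrow> 'b::ab_group_add set \<Rightarrow> ('a \<Rightarrow> 'b) \<Rightarrow> bool"
  where "linear_betw scale1 scale2 V W f \<longleftrightarrow> f \<in> V \<rightarrow> W \<and>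
    (\<forall>u\<in>V. \<forall>v\<in>V. f (u + v) = f u + f v) \<and> (\<forall>c. \<forall>u\<in>V. f (scale1 c u) = scale2 c (f u))"

text \<open>\<open>S\<^sup>n(\<complex>\<^sup>2)\<close> as the space of homogeneous polynomial functions of degree \<open>n\<close> on the dual of
  \<open>\<complex>\<^sup>2\<close>, whose elements \<open>\<xi>\<close> are given by their coordinates in the dual basis; \<open>g\<close> acts on a
  polynomial by precomposition with its transpose. For \<open>n = 1\<close> the function \<open>\<xi> \<mapsto> w\<^sub>1 \<xi>\<^sub>1 + w\<^sub>2 \<xi>\<^sub>2\<close>
  is sent to the function belonging to \<open>g w\<close>.\<close>

definition Sym_power :: "nat \<Rightarrow> (complex^2 \<Rightarrow> complex) set" where
  "Sym_power n = {p. \<exists>c. p = (\<lambda>\<xi>. \<Sum>j\<le>n. c j * (\<xi> $ 1) ^ j * (\<xi> $ 2) ^ (n - j))}"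

definition act_poly :: "complex^2^2 \<Rightarrow> (complex^2 \<Rightarrow> complex) \<Rightarrow> complex^2 \<Rightarrow> complex" where
  "act_poly g p = (\<lambda>\<xi>. p (transpose g *v \<xi>))"

definition iso_to_Sym_power :: "nat \<Rightarrow> sect set \<Rightarrow> bool" where
  "iso_to_Sym_power n W \<longleftrightarrow> (\<exists>\<phi>. bij_betw \<phi> (Sym_power n) W \<and>
     linear_betw (\<lambda>c p \<xi>. c * p \<xi>) sect_scale (Sym_power n) W \<phi> \<and>
     (\<forall>g\<in>SU2. \<forall>p\<in>Sym_power n. \<phi> (act_poly g p) = act_sect g (\<phi> p)))"

text \<open>\<open>Gamma_comp d\<close> is the summand of the space of \<open>L\<^sup>2\<close>-sections isomorphic to \<open>S\<^bsup>d-1\<^esup>(\<complex>\<^sup>2)\<close>, i.e. its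
  isotypic component (the summands being pairwise non-isomorphic). Since an \<open>L\<^sup>2\<close>-section is only
  defined almost everywhere, the elements of this finite-dimensional space are taken by their unique
  continuous representatives; this is what gives the evaluation \<open>s \<mapsto> s l\<close> a meaning.\<close>

definition Gamma_comp :: "nat \<Rightarrow> sect set" where
  "Gamma_comp d = sect.span (\<Union>{W. W \<subseteq> L2_sections \<inter> continuous_sections \<and> sect.subspace W \<and>
     (\<forall>g\<in>SU2. \<forall>s\<in>W. act_sect g s \<in> W) \<and> iso_to_Sym_power (d - 1) W})"

definition H_space :: "sect set" where
  "H_space = sect.span (\<Union>k\<in>{1..5}. Gamma_comp (2 * k))"

definition tau :: "sect \<Rightarrow> sect" where
  "tau s = (THE u. u \<in> Gamma_comp 2 \<and> s - u \<in> sect.span (\<Union>k\<in>{2..5}. Gamma_comp (2 * k)))"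

section \<open>Designs\<close>

definition design_data :: "(complex^2) set set \<Rightarrow> ((complex^2) set \<Rightarrow> complex^2 \<Rightarrow> sect) \<Rightarrow> bool" where
  "design_data X lam \<longleftrightarrow> finite X \<and> X \<subseteq> CP1 \<and>
     (\<forall>x\<in>X. linear_betw (*s) sect_scale x (Gamma_comp 2) (lam x))"

definition Psi ::
  "(complex^2) set set \<Rightarrow> ((complex^2) set \<Rightarrow> complex^2 \<Rightarrow> sect) \<Rightarrow> sect \<Rightarrow> sect" where
  "Psi X lam s = (\<Sum>x\<in>X. lam x (s x))"

definition tau_design :: "(complex^2) set set \<Rightarrow> ((complex^2) set \<Rightarrow> complex^2 \<Rightarrow> sect) \<Rightarrow> bool" where
  "tau_design X lam \<longleftrightarrow> design_data X lam \<and> (\<forall>s\<in>H_space. tau s = Psi X lam s)"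

definition act_lam :: "complex^2^2 \<Rightarrow> (complex^2 \<Rightarrow> sect) \<Rightarrow> complex^2 \<Rightarrow> sect" where
  "act_lam g mu = (\<lambda>z. act_sect g (mu (matrix_inv g *v z)))"

definition orbit_points :: "(complex^2^2) set \<Rightarrow> (complex^2) set set \<Rightarrow> (complex^2) set set" where
  "orbit_points G X = {act_line g x | g x. g \<in> G \<and> x \<in> X}"

definition orbit_lam ::
  "(complex^2^2) set \<Rightarrow> (complex^2) set set \<Rightarrow> ((complex^2) set \<Rightarrow> complex^2 \<Rightarrow> sect)
    \<Rightarrow> (complex^2) set \<Rightarrow> complex^2 \<Rightarrow> sect" where
  "orbit_lam G X lam y z = sect_scale (1 / of_nat (card G))
     (\<Sum>(g, x)\<in>{(g, x). g \<in> G \<and> x \<in> X \<and> act_line g x = y}. act_lam g (lam x) z)"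

text \<open>Trace of an endomorphism of a finite-dimensional space \<open>V\<close> of sections.\<close>

definition sect_trace :: "sect set \<Rightarrow> (sect \<Rightarrow> sect) \<Rightarrow> complex" where
  "sect_trace V f =
     (let B = (SOME B. \<not> sect.dependent B \<and> sect.span B = V)
      in \<Sum>b\<in>B. sect.representation B (f b) b)"

end

theory Submission
  imports Defs
begin

text \<open>With \<open>\<Psi>\<close> for the map of the given design, the averaged map is
  \<open>s \<mapsto> 1/120 \<Sum>\<^sub>g g \<Psi>(g\<^sup>-\<^sup>1 s)\<close>, hence equivariant under the icosahedral group, with values in
  \<open>\<Gamma>\<^sup>2\<close>. An equivariant map from \<open>S\<^sup>n(\<complex>\<^sup>2)\<close> to \<open>\<complex>\<^sup>2\<close> is zero for \<open>n = 3, 5, 7, 9\<close>: the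
  generators \<open>S\<close> and \<open>U\<close> leave at most two free coefficients, and these are killed by the image of
  the power \<open>x\<^sup>n\<close> under \<open>T\<close>. For \<open>n = 1\<close> it is a scalar, which the trace condition forces to be 1,
  because averaging preserves the trace. That each \<open>\<Gamma>\<^sup>2\<^sup>k\<close> is a single copy of \<open>S\<^sup>2\<^sup>k\<^sup>-\<^sup>1(\<complex>\<^sup>2)\<close> (or zero)
  is Frobenius reciprocity: an equivariant family of sections is determined by its values at one
  line, and there the weights of the stabilizer leave one free scalar. That \<open>\<Gamma>\<^sup>2\<close> is nonzero also
  comes from the trace condition, so no section ever has to be constructed.\<close>

section \<open>Two by two unitary matrices\<close>

text \<open>Behind the vanishing for n = 3, 5, 7, 9 stands invariant theory: equivariant maps from
  S^n(C^2) to C^2 correspond to icosahedral invariants in S^(n+1) + S^(n-1), and the invariant of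
  least positive degree has degree 12. So n = 1 leaves one scalar, and the summands have to stop at
  k = 5, because n = 11 would admit a nonzero map. The proof replaces these facts by equations for
  the three generators. The fixed factor 1/120 preserves the trace only if the generated group
  really has order 120; hence the group is identified with an explicit list of matrices.
  \<open>Gamma_comp\<close> is the span of all copies of a representation, so multiplicity one is
  needed before a component can be handled through a single isomorphism. Directness of the sum is
  not proved beforehand either: \<open>tau\<close> is a definite description, and the averaged map,
  being the identity on the first component and zero on the others, is itself what makes the
  decomposition unique. Likewise the trace refers to an arbitrary basis, whose finiteness is deduced
  from the trace being nonzero.\<close>

lemma mat2_eq_iff:
  "A = B \<longleftrightarrow> A $ 1 $ 1 = B $ 1 $ 1 \<and> A $ 1 $ 2 = B $ 1 $ 2 \<and> A $ 2 $ 1 = B $ 2 $ 1 \<and> A $ 2 $ 2 = B $ 2 $ 2"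
  for A B :: "'a^2^2"
  by (auto simp: vec_eq_iff forall_2)

lemma vec2_eq_iff: "v = w \<longleftrightarrow> v $ 1 = w $ 1 \<and> v $ 2 = w $ 2" for v w :: "'a^2"
  by (auto simp: vec_eq_iff forall_2)

lemma mat2_mult_entry: "(A ** B) $ i $ j = A $ i $ 1 * B $ 1 $ j + A $ i $ 2 * B $ 2 $ j"
  for A B :: "'a::semiring_1^2^2"
  by (simp add: matrix_matrix_mult_def sum_2)

lemma mat2_vec_entry: "(A *v v) $ i = A $ i $ 1 * v $ 1 + A $ i $ 2 * v $ 2"
  for A :: "'a::semiring_1^2^2"
  by (simp add: matrix_vector_mult_def sum_2)

text \<open>Every element of SU(2) has this shape and is therefore known by its first row, so group
  elements can be handled as pairs. The condition |a|^2 + |b|^2 = 1 is kept out of the definition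
  and asked for in \<open>su_in_SU2\<close>.\<close>

definition su :: "complex \<Rightarrow> complex \<Rightarrow> complex^2^2" where
  "su a b = vector [vector [a, b], vector [- cnj b, cnj a]]"

lemma su_entries [simp]:
  "su a b $ 1 $ 1 = a" "su a b $ 1 $ 2 = b" "su a b $ 2 $ 1 = - cnj b" "su a b $ 2 $ 2 = cnj a"
  by (simp_all add: su_def)

lemma su_eq_iff: "su a b = su c d \<longleftrightarrow> a = c \<and> b = d"
  by (auto simp: mat2_eq_iff)

lemma su_mult: "su a b ** su c d = su (a * c - b * cnj d) (a * d + b * cnj c)"
  by (simp add: mat2_eq_iff mat2_mult_entry algebra_simps)

lemma su_one: "su 1 0 = mat 1"
  by (simp add: mat2_eq_iff mat_def)

lemma conj_transpose_su: "conj_transpose (su a b) = su (cnj a) (- b)"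
  by (simp add: mat2_eq_iff conj_transpose_def)

lemma su_in_SU2:
  assumes "a * cnj a + b * cnj b = 1"
  shows "su a b \<in> SU2"
proof -
  have "cnj a * a + cnj b * b = 1" "a * cnj a + b * cnj b = 1"
    using assms by (simp_all add: mult.commute)
  then show ?thesis
    by (simp add: SU2_def conj_transpose_su su_mult su_one[symmetric] su_eq_iff det_2 algebra_simps)
qed

lemma conj_transpose_mult: "conj_transpose (A ** B) = conj_transpose B ** conj_transpose A"
  for A B :: "complex^2^2"
  by (simp add: mat2_eq_iff mat2_mult_entry conj_transpose_def algebra_simps)

lemma conj_transpose_conj_transpose [simp]: "conj_transpose (conj_transpose A) = A"
  by (simp add: conj_transpose_def vec_eq_iff)

lemma SU2_inverse:
  assumes "g \<in> SU2"
  shows "g ** conj_transpose g = mat 1" "conj_transpose g ** g = mat 1"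
    "matrix_inv g = conj_transpose g"
proof -
  show *: "g ** conj_transpose g = mat 1" "conj_transpose g ** g = mat 1"
    using assms by (auto simp: SU2_def)
  then have "g ** matrix_inv g = mat 1 \<and> matrix_inv g ** g = mat 1"
    unfolding matrix_inv_def by (rule someI[of "\<lambda>B. g ** B = mat 1 \<and> B ** g = mat 1", OF conjI])
  then show "matrix_inv g = conj_transpose g"
    by (metis * matrix_mul_assoc matrix_mul_lid matrix_mul_rid)
qed

lemma one_in_SU2: "mat 1 \<in> SU2"
  using su_in_SU2[of 1 0] by (simp add: su_one)

lemma mult_in_SU2:
  assumes "g \<in> SU2" "h \<in> SU2"
  shows "g ** h \<in> SU2"
proof -
  have "conj_transpose (g ** h) ** (g ** h) = conj_transpose h ** ((conj_transpose g ** g) ** h)"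
    by (simp add: conj_transpose_mult matrix_mul_assoc)
  moreover have "(g ** h) ** conj_transpose (g ** h) = g ** ((h ** conj_transpose h) ** conj_transpose g)"
    by (simp add: conj_transpose_mult matrix_mul_assoc)
  ultimately show ?thesis
    using assms by (simp add: SU2_def det_mul)
qed

lemma matrix_inv_in_SU2:
  assumes "g \<in> SU2"
  shows "matrix_inv g \<in> SU2"
proof -
  have "det (conj_transpose g) * det g = 1"
    using SU2_inverse(2)[OF assms] by (metis det_I det_mul)
  then have "det (conj_transpose g) = 1"
    using assms by (simp add: SU2_def)
  then show ?thesis
    using assms SU2_inverse(3)[OF assms] by (simp add: SU2_def)
qed

lemma SU2_inverse_mult:
  assumes "g \<in> SU2"
  shows "g ** matrix_inv g = mat 1" "matrix_inv g ** g = mat 1"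
  using SU2_inverse[OF assms] by auto

lemma matrix_inv_mult_SU2:
  assumes "g \<in> SU2" "h \<in> SU2"
  shows "matrix_inv (g ** h) = matrix_inv h ** matrix_inv g"
  using assms mult_in_SU2[OF assms] by (simp add: SU2_inverse conj_transpose_mult)

lemma matrix_inv_matrix_inv_SU2:
  assumes "g \<in> SU2"
  shows "matrix_inv (matrix_inv g) = g"
  using assms matrix_inv_in_SU2[OF assms] by (simp add: SU2_inverse)

lemma group_SU2: "group SU2_group"
proof (rule groupI)
  fix x assume "x \<in> carrier SU2_group"
  then show "\<exists>y\<in>carrier SU2_group. y \<otimes>\<^bsub>SU2_group\<^esub> x = \<one>\<^bsub>SU2_group\<^esub>"
    using matrix_inv_in_SU2 SU2_inverse_mult by (auto simp: SU2_group_def)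
qed (auto simp: SU2_group_def mult_in_SU2 one_in_SU2 matrix_mul_assoc)

lemma inv_SU2_group:
  assumes "g \<in> SU2"
  shows "inv\<^bsub>SU2_group\<^esub> g = matrix_inv g"
  using group.inv_equality[OF group_SU2, of "matrix_inv g" g] assms
    matrix_inv_in_SU2[OF assms] SU2_inverse_mult[OF assms]
  by (simp add: SU2_group_def)

section \<open>The order of the binary icosahedral group\<close>

locale fifth_root =
  fixes \<epsilon> :: complex
  assumes primitive: "primitive_root_of_unity 5 \<epsilon>"
begin

section \<open>Arithmetic of the constants in the fifth cyclotomic field\<close>

definition \<alpha> :: complex where "\<alpha> = \<epsilon> + \<epsilon> ^ 4"
definition \<beta> :: complex where "\<beta> = \<epsilon> ^ 2 - \<epsilon> ^ 3"
definition B :: complex where "B = 1 / \<beta>"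

lemma eps5: "\<epsilon> ^ 5 = 1"
  using primitive by (simp add: primitive_root_of_unity_def)

lemma eps_ne: "\<epsilon> \<noteq> 0" "\<epsilon> \<noteq> 1"
  using primitive power_one_right[of \<epsilon>] 
  by (auto simp: primitive_root_of_unity_def dest!: spec[of _ 1])

lemma cyclotomic: "1 + \<epsilon> + \<epsilon> ^ 2 + \<epsilon> ^ 3 + \<epsilon> ^ 4 = 0"
proof -
  have "(\<epsilon> - 1) * (1 + \<epsilon> + \<epsilon> ^ 2 + \<epsilon> ^ 3 + \<epsilon> ^ 4) = 0"
    using eps5 by algebra
  then show ?thesis
    using eps_ne by simp
qed

text \<open>\<open>\<alpha>\<close> is (-1 + sqrt 5)/2 or (-1 - sqrt 5)/2, depending on the choice
  of \<open>\<epsilon>\<close>. The relation reduces every power of it to a linear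
  expression.\<close>

lemma alpha_sq: "\<alpha> ^ 2 = 1 - \<alpha>"
  using cyclotomic unfolding \<alpha>_def by algebra

lemma beta_sq: "\<beta> ^ 2 = \<alpha> - 2"
  using cyclotomic unfolding \<alpha>_def \<beta>_def by algebra

lemma alpha_power5: "\<alpha> ^ 5 = 5 * \<alpha> - 3"
  using alpha_sq by algebra

text \<open>This stands in for the irrationality of \<open>\<alpha>\<close>: putting s/r into x^2 +
  x - 1 and clearing denominators lets a relation with integers \<open>r\<close> and
  \<open>s\<close> be refuted by evaluating one numeral.\<close>

lemma rational_not_alpha_root:
  fixes r s :: complex
  assumes "r * \<alpha> = s"
  shows "s * s + s * r - r * r = 0"
  using alpha_sq assms by algebra

lemma alpha_ne: "\<alpha> \<noteq> 0" "\<beta> \<noteq> 0" "B \<noteq> 0" "B * \<beta> = 1"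
proof -
  show "\<alpha> \<noteq> 0" using alpha_sq by auto
  show "\<beta> \<noteq> 0"
    using beta_sq alpha_sq by (auto simp: algebra_simps)
  then show "B \<noteq> 0" "B * \<beta> = 1" by (auto simp: B_def)
qed

text \<open>Keeps apart the two families of \<open>first_rows\<close> that involve
  \<open>\<alpha>\<close>: a common row would make \<open>\<alpha>\<close> a quotient of two tenth
  roots of unity.\<close>

lemma alpha_power10_ne: "\<alpha> ^ 10 \<noteq> 1"
proof
  assume "\<alpha> ^ 10 = 1"
  then have "(5 * \<alpha> - 3) ^ 2 = 1"
    using alpha_power5 power_mult[of \<alpha> 5 2] by simp
  then have "55 * \<alpha> = 33"
    using alpha_sq by algebra
  from rational_not_alpha_root[OF this] show False by simp
qed

lemma cnj_root_of_unity:
  assumes "u ^ n = 1" "0 < n"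
  shows "u * cnj u = 1"
proof -
  have "norm u ^ n = 1"
    using assms by (simp flip: norm_power)
  then have "norm u = 1"
    using assms(2) power_eq_imp_eq_base[of "norm u" n 1] by simp
  then show ?thesis
    by (simp add: complex_norm_square[symmetric])
qed

lemma cnj_eps: "cnj \<epsilon> = \<epsilon> ^ 4"
proof -
  have "\<epsilon> * cnj \<epsilon> = \<epsilon> * \<epsilon> ^ 4"
    using cnj_root_of_unity[OF eps5] eps5 by (simp add: power_numeral_reduce)
  then show ?thesis using eps_ne by simp
qed

lemma cnj_constants: "cnj \<alpha> = \<alpha>" "cnj \<beta> = - \<beta>" "cnj B = - B"
proof -
  show "cnj \<alpha> = \<alpha>"
    using eps5 unfolding \<alpha>_def by (simp add: cnj_eps) algebra
  show "cnj \<beta> = - \<beta>"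
    using eps5 unfolding \<beta>_def by (simp add: cnj_eps) algebra
  then show "cnj B = - B"
    by (simp add: B_def)
qed

lemma fifth_roots_of_unity: 
  assumes "z ^ 5 = 1"
  shows "z \<in> {1, \<epsilon>, \<epsilon> ^ 2, \<epsilon> ^ 3, \<epsilon> ^ 4}"
proof -
  \<comment> \<open>The product is z^5 - 1, split into linear factors over the powers of
    \<open>\<epsilon>\<close>.\<close>
  have "(z - 1) * ((z - \<epsilon>) * ((z - \<epsilon> ^ 2) * ((z - \<epsilon> ^ 3) * (z - \<epsilon> ^ 4)))) = 0"
    using assms cyclotomic by algebra
  then show ?thesis by auto
qed

section \<open>The generators as SU(2) matrices and closure of the generated group\<close>

lemma icosa_generators_eq:
  "icosa_S \<epsilon> = su (\<epsilon> ^ 3) 0" "icosa_T \<epsilon> = su (\<alpha> * B) B" "icosa_U = su 0 1"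
proof -
  have "\<epsilon> ^ 12 = \<epsilon> ^ 2" using eps5 by algebra
  then have "(\<epsilon> ^ 4) ^ 3 = \<epsilon> ^ 2"
    by (simp flip: power_mult)
  then show "icosa_S \<epsilon> = su (\<epsilon> ^ 3) 0"
    by (simp add: mat2_eq_iff icosa_S_def cnj_eps)
  show "icosa_T \<epsilon> = su (\<alpha> * B) B"
    by (simp add: mat2_eq_iff icosa_T_def cnj_constants) (simp add: \<alpha>_def \<beta>_def B_def add_divide_distrib diff_divide_distrib)
  show "icosa_U = su 0 1"
    by (simp add: mat2_eq_iff icosa_U_def)
qed

lemma icosa_generators_SU2: "icosa_S \<epsilon> \<in> SU2" "icosa_T \<epsilon> \<in> SU2" "icosa_U \<in> SU2"
proof -
  have "(\<epsilon> ^ 3) ^ 5 = 1" using eps5 by (metis power_mult mult.commute power_one)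
  from cnj_root_of_unity[OF this] show "icosa_S \<epsilon> \<in> SU2"
    unfolding icosa_generators_eq by (intro su_in_SU2) simp
  have "\<alpha> * B * cnj (\<alpha> * B) + B * cnj B = 1"
    using alpha_ne(4) beta_sq alpha_sq by (simp add: cnj_constants) algebra
  then show "icosa_T \<epsilon> \<in> SU2"
    unfolding icosa_generators_eq by (intro su_in_SU2)
  show "icosa_U \<in> SU2"
    unfolding icosa_generators_eq by (intro su_in_SU2) simp
qed

lemma G_icosa_SU2: "G_icosa \<epsilon> \<subseteq> SU2"
proof
  fix g assume "g \<in> G_icosa \<epsilon>"
  moreover have "{icosa_S \<epsilon>, icosa_T \<epsilon>, icosa_U} \<subseteq> carrier SU2_group"
    using icosa_generators_SU2 by (simp add: SU2_group_def)
  ultimately have "g \<in> carrier SU2_group"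
    unfolding G_icosa_def by (intro group.generate_in_carrier[OF group_SU2])
  then show "g \<in> SU2" by (simp add: SU2_group_def)
qed

lemma G_icosa_one: "mat 1 \<in> G_icosa \<epsilon>"
  using generate.one[of SU2_group] by (simp add: G_icosa_def SU2_group_def)

lemma G_icosa_mult: "g \<in> G_icosa \<epsilon> \<Longrightarrow> h \<in> G_icosa \<epsilon> \<Longrightarrow> g ** h \<in> G_icosa \<epsilon>"
  using generate.eng[of _ SU2_group] by (simp add: G_icosa_def SU2_group_def)

lemma G_icosa_generators: "icosa_S \<epsilon> \<in> G_icosa \<epsilon>" "icosa_T \<epsilon> \<in> G_icosa \<epsilon>" "icosa_U \<in> G_icosa \<epsilon>"
  by (auto simp: G_icosa_def intro: generate.incl)

lemma G_icosa_inverse: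
  assumes "g \<in> G_icosa \<epsilon>"
  shows "matrix_inv g \<in> G_icosa \<epsilon>"
proof -
  have "inv\<^bsub>SU2_group\<^esub> g \<in> G_icosa \<epsilon>"
    using group.generate_m_inv_closed[OF group_SU2, of "{icosa_S \<epsilon>, icosa_T \<epsilon>, icosa_U}" g]
      assms icosa_generators_SU2
    by (auto simp: G_icosa_def SU2_group_def)
  then show ?thesis
    using inv_SU2_group assms G_icosa_SU2 by auto
qed

section \<open>The 120 group elements, listed by their first rows\<close>

text \<open>The first rows of the matrices \<open>D\<close>, \<open>D U\<close>, \<open>D T D'\<close>, \<open>D T D' U\<close> with \<open>D = diag(p, p\<^sup>-\<^sup>1)\<close>,
  \<open>D' = diag(q, q\<^sup>-\<^sup>1)\<close> and \<open>p\<^sup>1\<^sup>0 = q\<^sup>1\<^sup>0 = 1\<close>; here \<open>u = p q\<close> and \<open>v = p / q\<close> in the third case.\<close>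

definition first_rows :: "(complex \<times> complex) set" where
  "first_rows = (\<lambda>p. (p, 0)) ` {p. p ^ 10 = 1} \<union> (\<lambda>p. (0, p)) ` {p. p ^ 10 = 1}
    \<union> (\<lambda>(u, v). (\<alpha> * B * u, B * v)) ` (SIGMA u:{u. u ^ 10 = 1}. {v. v ^ 5 = u ^ 5})
    \<union> (\<lambda>(u, v). (B * u, \<alpha> * B * v)) ` (SIGMA u:{u. u ^ 10 = 1}. {v. v ^ 5 = - (u ^ 5)})"

lemma first_rowsI:
  "p ^ 10 = 1 \<Longrightarrow> (p, 0) \<in> first_rows"
  "p ^ 10 = 1 \<Longrightarrow> (0, p) \<in> first_rows"
  "u ^ 10 = 1 \<Longrightarrow> v ^ 5 = u ^ 5 \<Longrightarrow> (\<alpha> * B * u, B * v) \<in> first_rows"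
  "u ^ 10 = 1 \<Longrightarrow> v ^ 5 = - (u ^ 5) \<Longrightarrow> (B * u, \<alpha> * B * v) \<in> first_rows"
  unfolding first_rows_def by force+

lemma first_rowsE:
  assumes "(a, b) \<in> first_rows"
  obtains (diag) "a ^ 10 = 1" "b = 0"
  | (antidiag) "a = 0" "b ^ 10 = 1"
  | (T) u v where "u ^ 10 = 1" "v ^ 5 = u ^ 5" "a = \<alpha> * B * u" "b = B * v"
  | (TU) u v where "u ^ 10 = 1" "v ^ 5 = - (u ^ 5)" "a = B * u" "b = \<alpha> * B * v"
  using assms unfolding first_rows_def by force

text \<open>The count is 10 + 10 + 50 + 50, since \<open>u\<close> has ten values and each leaves
  five for \<open>v\<close>. Zero entries separate all families except the last two, which
  \<open>alpha_power10_ne\<close> separates.\<close>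

lemma card_first_rows: "card first_rows = 120"
proof -
  define R :: "complex set" where "R = {p. p ^ 10 = 1}"
  define Q where "Q s = (SIGMA u:R. {v. v ^ 5 = s * u ^ 5})" for s :: complex
  have R: "finite R" "card R = 10"
    unfolding R_def by (simp_all add: card_roots_unity_eq finite_roots_unity)
  have R0: "0 \<notin> R" by (simp add: R_def)
  have Q: "finite (Q s)" "card (Q s) = 50" if "s ^ 2 = 1" for s
  proof -
    have c: "card {v. v ^ 5 = s * u ^ 5} = 5" "finite {v. v ^ 5 = s * u ^ 5}" if "u \<in> R" for u
    proof -
      have "s \<noteq> 0" "u \<noteq> 0" using that \<open>s ^ 2 = 1\<close> R0 by auto
      then show "card {v. v ^ 5 = s * u ^ 5} = 5" "finite {v. v ^ 5 = s * u ^ 5}"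
        by (simp_all add: card_nth_roots finite_nth_roots)
    qed
    then show "finite (Q s)" unfolding Q_def using R by auto
    show "card (Q s) = 50"
      unfolding Q_def using c R by (subst card_SigmaI) auto
  qed
  let ?a = "\<lambda>p::complex. (p, 0::complex)" and ?b = "\<lambda>p::complex. (0::complex, p)"
  let ?c = "\<lambda>(u, v). (\<alpha> * B * u, B * v)" and ?d = "\<lambda>(u, v). (B * u, \<alpha> * B * v)"
  have eq: "first_rows = ?a ` R \<union> (?b ` R \<union> (?c ` Q 1 \<union> ?d ` Q (-1)))"
    unfolding first_rows_def R_def Q_def by simp blast
  have Qne: "u \<noteq> 0 \<and> v \<noteq> 0" if "(u, v) \<in> Q s" "s ^ 2 = 1" for u v s
    using that R0 by (auto simp: Q_def)
  have inj: "inj_on ?a R" "inj_on ?b R" "inj_on ?c (Q 1)" "inj_on ?d (Q (-1))"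
    using alpha_ne by (auto simp: inj_on_def)
  have disj1: "?a ` R \<inter> (?b ` R \<union> (?c ` Q 1 \<union> ?d ` Q (-1))) = {}"
    using R0 alpha_ne Qne[of _ _ 1] Qne[of _ _ "-1"] by auto
  have disj2: "?b ` R \<inter> (?c ` Q 1 \<union> ?d ` Q (-1)) = {}"
    using R0 alpha_ne Qne[of _ _ 1] Qne[of _ _ "-1"] by auto
  have disj3: "?c ` Q 1 \<inter> ?d ` Q (-1) = {}"
  proof -
    have False if "u \<in> R" "u' \<in> R" "\<alpha> * B * u = B * u'" for u u'
    proof -
      have "\<alpha> * u = u'" using that alpha_ne by simp
      then have "\<alpha> ^ 10 * u ^ 10 = u' ^ 10" by (metis power_mult_distrib)
      then show False using that alpha_power10_ne by (simp add: R_def)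
    qed
    moreover have "u \<in> R" "v \<in> R" if "(u, v) \<in> Q s" "s ^ 2 = 1" for u v s
      using that power_mult[of u 5 2] power_mult[of v 5 2]
      by (auto simp: Q_def R_def power_mult_distrib)
    ultimately show ?thesis by fastforce
  qed
  show ?thesis
    unfolding eq using R Q[of 1] Q[of "-1"] inj disj1 disj2 disj3
    by (simp add: card_Un_disjoint card_image)
qed

lemma eps_power_eq_1: "5 dvd k \<Longrightarrow> \<epsilon> ^ k = 1"
  using eps5 by (auto simp: power_mult)

text \<open>For a fifth root of unity z, multiplying a row of the third or fourth family by T
  produces the coefficients B(\<alpha>^2 + z) and B \<alpha> (1 - z). For z = 1 the second one
  vanishes; otherwise one of the two is a root of unity up to sign and the other is
  \<open>\<alpha>\<close> times such a root, and which is which decides the family of the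
  product.\<close>

lemma T_multiplication_identities:
  "B * (\<alpha>^2 + 1) = - \<beta>"
  "B * (\<alpha>^2 + \<epsilon>^4) = \<epsilon>^3" "B * (\<alpha> * (1 - \<epsilon>^4)) = - \<alpha> * \<epsilon>^2"
  "B * (\<alpha>^2 + \<epsilon>^3) = \<alpha> * \<epsilon>^2" "B * (\<alpha> * (1 - \<epsilon>^3)) = \<epsilon>^4"
  "B * (\<alpha>^2 + \<epsilon>^2) = - \<alpha> * \<epsilon>^3" "B * (\<alpha> * (1 - \<epsilon>^2)) = - \<epsilon>"
  "B * (\<alpha>^2 + \<epsilon>) = - (\<epsilon>^2)" "B * (\<alpha> * (1 - \<epsilon>)) = \<alpha> * \<epsilon>^3"
proof -
  have *: "B * x = y" if "x = \<beta> * y" for x y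
    using that alpha_ne by (simp add: B_def)
  show "B * (\<alpha>^2 + 1) = - \<beta>"
    using cyclotomic unfolding \<alpha>_def \<beta>_def by (intro *[unfolded \<beta>_def]) algebra
  show "B * (\<alpha>^2 + \<epsilon>^4) = \<epsilon>^3" "B * (\<alpha> * (1 - \<epsilon>^4)) = - \<alpha> * \<epsilon>^2"
    "B * (\<alpha>^2 + \<epsilon>^3) = \<alpha> * \<epsilon>^2" "B * (\<alpha> * (1 - \<epsilon>^3)) = \<epsilon>^4"
    "B * (\<alpha>^2 + \<epsilon>^2) = - \<alpha> * \<epsilon>^3" "B * (\<alpha> * (1 - \<epsilon>^2)) = - \<epsilon>"
    "B * (\<alpha>^2 + \<epsilon>) = - (\<epsilon>^2)" "B * (\<alpha> * (1 - \<epsilon>)) = \<alpha> * \<epsilon>^3"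
    using cyclotomic unfolding \<alpha>_def \<beta>_def by (intro *[unfolded \<beta>_def]; algebra)+
qed


text \<open>The pair is the first row of T times \<open>su a b\<close>. T carries the diagonal
  family into the third one and the antidiagonal family into the fourth; on the last two families
  the conjugates can be eliminated, which leaves five cases each.\<close>

lemma first_rows_T:
  assumes "(a, b) \<in> first_rows"
  shows "(\<alpha> * B * a - B * cnj b, \<alpha> * B * b + B * cnj a) \<in> first_rows"
  using assms
proof (cases rule: first_rowsE)
  case diag
  have "a * cnj a = 1" using cnj_root_of_unity[of a 10] diag by simp
  then have "a ^ 10 * cnj a ^ 5 = a ^ 5" by algebra
  then show ?thesis
    using first_rowsI(3)[of a "cnj a"] diag by simp
next
  case antidiag
  have "b * cnj b = 1" using cnj_root_of_unity[of b 10] antidiag by simp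
  then have "b ^ 10 * cnj b ^ 5 = b ^ 5" "b ^ 10 * cnj b ^ 10 = 1" by algebra+
  then show ?thesis
    using first_rowsI(4)[of "- cnj b" b] antidiag by (simp add: mult.commute power_minus_odd)
next
  case (T u v)
  have "v ^ 10 = 1" using T power_mult[of u 5 2] power_mult[of v 5 2] by simp
  then have uv: "u * cnj u = 1" "v * cnj v = 1" using cnj_root_of_unity[of _ 10] T by simp_all
  \<comment> \<open>Because \<open>v ^ 5 = u ^ 5\<close>, this is a fifth root of unity. Its inverse
    \<open>z\<close> expresses the conjugates through the variables themselves,
    \<open>cnj v = z * u\<close> and \<open>cnj u = z * v\<close>, so only the value of
    \<open>z\<close> matters.\<close>
  define w where "w = u * v"
  have "u ^ 10 = w ^ 5" using T unfolding w_def by algebra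
  then have "w \<in> {1, \<epsilon>, \<epsilon> ^ 2, \<epsilon> ^ 3, \<epsilon> ^ 4}"
    using fifth_roots_of_unity T by simp
  then obtain z where w: "(z, w) \<in> {(1, 1), (\<epsilon> ^ 4, \<epsilon>), (\<epsilon> ^ 3, \<epsilon> ^ 2), (\<epsilon> ^ 2, \<epsilon> ^ 3), (\<epsilon>, \<epsilon> ^ 4)}"
    by auto
  then have "z * w = 1" using eps5 by (auto simp: power_numeral_reduce ac_simps)
  then have conj: "cnj v = z * u" "cnj u = z * v"
    using uv unfolding w_def by algebra+
  have "\<alpha> * B * a - B * cnj b = B * (B * (\<alpha>^2 + z)) * u"
    "\<alpha> * B * b + B * cnj a = B * (B * (\<alpha> * (1 - z))) * v"
    by (simp_all add: T cnj_constants conj algebra_simps power2_eq_square)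
  moreover have "(B * (B * (\<alpha>^2 + z)) * u, B * (B * (\<alpha> * (1 - z))) * v) \<in> first_rows"
    using w
  proof (elim insertE)
    assume "(z, w) = (1, 1)"
    then show ?thesis
      using first_rowsI(1)[of "- u"] T alpha_ne by (simp add: T_multiplication_identities)
  next
    assume "(z, w) = (\<epsilon> ^ 4, \<epsilon>)"
    then show ?thesis
      using first_rowsI(4)[of "\<epsilon>^3 * u" "- (\<epsilon>^2 * v)"] T
      by (simp add: T_multiplication_identities power_mult_distrib power_minus_odd eps_power_eq_1 mult_ac)
  next
    assume "(z, w) = (\<epsilon> ^ 3, \<epsilon> ^ 2)"
    then show ?thesis
      using first_rowsI(3)[of "\<epsilon>^2 * u" "\<epsilon>^4 * v"] T
      by (simp add: T_multiplication_identities power_mult_distrib eps_power_eq_1 mult_ac)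
  next
    assume "(z, w) = (\<epsilon> ^ 2, \<epsilon> ^ 3)"
    then show ?thesis
      using first_rowsI(3)[of "- (\<epsilon>^3 * u)" "- (\<epsilon> * v)"] T
      by (simp add: T_multiplication_identities power_mult_distrib power_minus_odd eps_power_eq_1 mult_ac)
  next
    assume "(z, w) = (\<epsilon>, \<epsilon> ^ 4)"
    then show ?thesis
      using first_rowsI(4)[of "- (\<epsilon>^2 * u)" "\<epsilon>^3 * v"] T
      by (simp add: T_multiplication_identities power_mult_distrib power_minus_odd eps_power_eq_1 mult_ac)
  qed simp
  ultimately show ?thesis by simp
next
  case (TU u v)
  have "v ^ 10 = 1" using TU power_mult[of u 5 2] power_mult[of v 5 2] by simp
  then have uv: "u * cnj u = 1" "v * cnj v = 1" using cnj_root_of_unity[of _ 10] TU by simp_all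
  \<comment> \<open>The sign compensates for \<open>v ^ 5 = - (u ^ 5)\<close> and makes
    \<open>w\<close> a fifth root of unity again.\<close>
  define w where "w = - (u * v)"
  have "u ^ 10 = w ^ 5" using TU unfolding w_def by algebra
  then have "w \<in> {1, \<epsilon>, \<epsilon> ^ 2, \<epsilon> ^ 3, \<epsilon> ^ 4}"
    using fifth_roots_of_unity TU by simp
  then obtain z where w: "(z, w) \<in> {(1, 1), (\<epsilon> ^ 4, \<epsilon>), (\<epsilon> ^ 3, \<epsilon> ^ 2), (\<epsilon> ^ 2, \<epsilon> ^ 3), (\<epsilon>, \<epsilon> ^ 4)}"
    by auto
  then have "z * w = 1" using eps5 by (auto simp: power_numeral_reduce ac_simps)
  then have conj: "cnj v = - (z * u)" "cnj u = - (z * v)"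
    using uv unfolding w_def by algebra+
  have "\<alpha> * B * a - B * cnj b = B * (B * (\<alpha> * (1 - z))) * u"
    "\<alpha> * B * b + B * cnj a = B * (B * (\<alpha>^2 + z)) * v"
    by (simp_all add: TU cnj_constants conj algebra_simps power2_eq_square)
  moreover have "(B * (B * (\<alpha> * (1 - z))) * u, B * (B * (\<alpha>^2 + z)) * v) \<in> first_rows"
    using w
  proof (elim insertE)
    assume "(z, w) = (1, 1)"
    then show ?thesis
      using first_rowsI(2)[of "- v"] \<open>v ^ 10 = 1\<close> alpha_ne by (simp add: T_multiplication_identities)
  next
    assume "(z, w) = (\<epsilon> ^ 4, \<epsilon>)"
    then show ?thesis
      using first_rowsI(3)[of "- (\<epsilon>^2 * u)" "\<epsilon>^3 * v"] TU
      by (simp add: T_multiplication_identities power_mult_distrib power_minus_odd eps_power_eq_1 mult_ac)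
  next
    assume "(z, w) = (\<epsilon> ^ 3, \<epsilon> ^ 2)"
    then show ?thesis
      using first_rowsI(4)[of "\<epsilon>^4 * u" "\<epsilon>^2 * v"] TU
      by (simp add: T_multiplication_identities power_mult_distrib eps_power_eq_1 mult_ac)
  next
    assume "(z, w) = (\<epsilon> ^ 2, \<epsilon> ^ 3)"
    then show ?thesis
      using first_rowsI(4)[of "- (\<epsilon> * u)" "- (\<epsilon>^3 * v)"] TU
      by (simp add: T_multiplication_identities power_mult_distrib power_minus_odd eps_power_eq_1 mult_ac)
  next
    assume "(z, w) = (\<epsilon>, \<epsilon> ^ 4)"
    then show ?thesis
      using first_rowsI(3)[of "\<epsilon>^3 * u" "- (\<epsilon>^2 * v)"] TU
      by (simp add: T_multiplication_identities power_mult_distrib power_minus_odd eps_power_eq_1 mult_ac)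
  qed simp
  ultimately show ?thesis by simp
qed

lemma first_rows_S:
  assumes "(a, b) \<in> first_rows"
  shows "(\<epsilon> ^ 3 * a, \<epsilon> ^ 3 * b) \<in> first_rows"
  using assms
proof (cases rule: first_rowsE)
  case (T u v)
  then show ?thesis
    using first_rowsI(3)[of "\<epsilon> ^ 3 * u" "\<epsilon> ^ 3 * v"]
    by (simp add: power_mult_distrib eps_power_eq_1 mult_ac)
next
  case (TU u v)
  then show ?thesis
    using first_rowsI(4)[of "\<epsilon> ^ 3 * u" "\<epsilon> ^ 3 * v"]
    by (simp add: power_mult_distrib eps_power_eq_1 mult_ac)
qed (use first_rowsI in \<open>auto simp: power_mult_distrib eps_power_eq_1\<close>)

lemma first_rows_U:
  assumes "(a, b) \<in> first_rows"
  shows "(- cnj b, cnj a) \<in> first_rows"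
  using assms
proof (cases rule: first_rowsE)
  case (T u v)
  have "v ^ 10 = 1" using T power_mult[of u 5 2] power_mult[of v 5 2] by simp
  moreover have "cnj v ^ 5 = cnj u ^ 5" using T by (metis complex_cnj_power)
  ultimately show ?thesis
    using first_rowsI(4)[of "cnj v" "- cnj u"] T
    by (simp add: cnj_constants power_minus_odd flip: complex_cnj_power)
next
  case (TU u v)
  have "v ^ 10 = 1" using TU power_mult[of u 5 2] power_mult[of v 5 2] by simp
  moreover have "cnj v ^ 5 = - (cnj u ^ 5)" using TU by (metis complex_cnj_power complex_cnj_minus)
  ultimately show ?thesis
    using first_rowsI(3)[of "cnj v" "- cnj u"] TU
    by (simp add: cnj_constants power_minus_odd flip: complex_cnj_power)
qed (use first_rowsI in \<open>auto simp flip: complex_cnj_power\<close>)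

text \<open>It is enough that the list is stable under left multiplication by the generators, since
  it contains the identity; that it is a group need not be known. Inverse generators are covered by
  finiteness: left multiplication by a generator is an injective map of the finite list to itself,
  hence onto, and so can be undone within the list.\<close>

lemma G_icosa_subset: "G_icosa \<epsilon> \<subseteq> (\<lambda>(a, b). su a b) ` first_rows"
proof
  let ?E = "(\<lambda>(a, b). su a b) ` first_rows"
  have gens: "\<forall>e\<in>?E. h ** e \<in> ?E" if "h \<in> {icosa_S \<epsilon>, icosa_T \<epsilon>, icosa_U}" for h
    using that first_rows_S first_rows_T first_rows_U
    by (fastforce simp: icosa_generators_eq su_mult cnj_constants)
  have fin: "finite ?E"
    using card_first_rows card_ge_0_finite[of first_rows] by simp
  have SU2: "{icosa_S \<epsilon>, icosa_T \<epsilon>, icosa_U} \<subseteq> SU2"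
    using icosa_generators_SU2 by simp
  have closed: "\<forall>e\<in>?E. g ** e \<in> ?E" if "g \<in> generate SU2_group {icosa_S \<epsilon>, icosa_T \<epsilon>, icosa_U}" for g
    using that
  proof (induction rule: generate.induct)
    case (inv h)
    then have h: "h \<in> SU2" using SU2 by blast
    have inj: "inj_on ((**) h) ?E"
      by (rule inj_on_inverseI[where g = "(**) (matrix_inv h)"])
        (simp add: matrix_mul_assoc SU2_inverse_mult[OF h])
    have "(**) h ` ?E = ?E"
      using gens[OF inv] by (intro endo_inj_surj[OF fin _ inj]) blast
    then have preimage: "\<exists>e'\<in>?E. e = h ** e'" if "e \<in> ?E" for e
      using that by blast
    show ?case
    proof
      fix e assume "e \<in> ?E"
      then obtain e' where "e' \<in> ?E" "e = h ** e'" using preimage by blast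
      then show "inv\<^bsub>SU2_group\<^esub> h ** e \<in> ?E"
        by (simp add: inv_SU2_group[OF h] matrix_mul_assoc SU2_inverse_mult[OF h])
    qed
  next
    case (eng h1 h2)
    show ?case
    proof
      fix e assume "e \<in> ?E"
      then have "h1 ** (h2 ** e) \<in> ?E" using eng.IH by blast
      then show "h1 \<otimes>\<^bsub>SU2_group\<^esub> h2 ** e \<in> ?E"
        by (simp add: SU2_group_def matrix_mul_assoc)
    qed
  qed (use gens in \<open>simp_all add: SU2_group_def\<close>)
  fix g assume "g \<in> G_icosa \<epsilon>"
  moreover have "mat 1 \<in> ?E"
    using first_rowsI(1)[of 1] by (force simp: su_one[symmetric])
  ultimately have "g ** mat 1 \<in> ?E" using closed unfolding G_icosa_def by blast
  then show "g \<in> ?E" by simp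
qed

text \<open>Powers of S supply all fifth roots of unity, as 3 is invertible modulo 5, and U^2 = -1
  supplies their negatives.\<close>

lemma G_icosa_diagonal:
  assumes "p ^ 10 = 1"
  shows "su p 0 \<in> G_icosa \<epsilon>"
proof -
  have eps: "su (\<epsilon> ^ (3 * n)) 0 \<in> G_icosa \<epsilon>" for n
  proof (induction n)
    case (Suc n)
    then show ?case
      using G_icosa_mult[OF G_icosa_generators(1) Suc]
      by (simp add: icosa_generators_eq su_mult power_add power_numeral_reduce ac_simps)
  qed (use G_icosa_one in \<open>simp add: su_one\<close>)
  have fifth: "su z 0 \<in> G_icosa \<epsilon>" if "z ^ 5 = 1" for z
  proof -
    have "\<epsilon> ^ 6 = \<epsilon>" "\<epsilon> ^ 12 = \<epsilon> ^ 2" "\<epsilon> ^ 9 = \<epsilon> ^ 4"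
      using eps5 by algebra+
    then show ?thesis
      using fifth_roots_of_unity[OF that] eps[of 0] eps[of 2] eps[of 4] eps[of 1] eps[of 3] by auto
  qed
  have minus: "su (- 1) 0 \<in> G_icosa \<epsilon>"
    using G_icosa_mult[OF G_icosa_generators(3) G_icosa_generators(3)]
    by (simp add: icosa_generators_eq su_mult)
  have "p ^ 5 = 1 \<or> p ^ 5 = - 1"
    using power2_eq_1_iff[of "p ^ 5"] assms by simp
  then consider "p ^ 5 = 1" | "(- p) ^ 5 = 1"
    by (auto simp: power_minus_odd)
  then show ?thesis
  proof cases
    case 2
    then show ?thesis
      using G_icosa_mult[OF minus fifth[OF 2]] by (simp add: su_mult)
  qed (rule fifth)
qed

lemma G_icosa_eq: "G_icosa \<epsilon> = (\<lambda>(a, b). su a b) ` first_rows"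
proof
  have U: "su b a \<in> G_icosa \<epsilon>" if "su a (- b) \<in> G_icosa \<epsilon>" for a b
    using G_icosa_mult[OF that G_icosa_generators(3)] by (simp add: icosa_generators_eq su_mult)
  have T: "su (\<alpha> * B * u) (B * v) \<in> G_icosa \<epsilon>" if "u ^ 10 = 1" "v ^ 5 = u ^ 5" for u v
  proof -
    have uv: "(u * v) ^ 5 = 1" "v ^ 10 = 1"
      using that power_mult[of u 5 2] power_mult[of v 5 2]
      by (simp_all add: power_mult_distrib power2_eq_square flip: power_add)
    \<comment> \<open>The equations p q = u and p/q = v require a square root of u v. As u v is a
      fifth root of unity, its cube is one: (u v)^6 = u v.\<close>
    define p where "p = (u * v) ^ 3"
    have p: "p ^ 10 = 1" "p ^ 2 = u * v"
      using uv unfolding p_def by algebra+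
    have pc: "p * cnj p = 1" "u * cnj u = 1"
      using cnj_root_of_unity[of _ 10] p that by simp_all
    define q where "q = cnj p * u"
    have q: "q ^ 10 = 1"
      using that p unfolding q_def by (simp add: power_mult_distrib flip: complex_cnj_power)
    have "p * q = u" "p * cnj q = v"
      using pc p(2) unfolding q_def complex_cnj_mult complex_cnj_cnj by algebra+
    moreover have "su p 0 ** icosa_T \<epsilon> ** su q 0 \<in> G_icosa \<epsilon>"
      using G_icosa_diagonal p q G_icosa_generators G_icosa_mult by simp
    ultimately show ?thesis
      by (simp add: icosa_generators_eq su_mult ac_simps)
        (metis mult.assoc mult.commute)
  qed
  show "(\<lambda>(a, b). su a b) ` first_rows \<subseteq> G_icosa \<epsilon>"
  proof clarify
    fix a b assume "(a, b) \<in> first_rows"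
    then show "su a b \<in> G_icosa \<epsilon>"
    proof (cases rule: first_rowsE)
      case antidiag
      then show ?thesis using U[of b 0] G_icosa_diagonal[of b] by simp
    next
      case (TU u v)
      have "v ^ 10 = 1" using TU power_mult[of u 5 2] power_mult[of v 5 2] by simp
      then show ?thesis
        using U[of "\<alpha> * B * v" "B * u"] T[of v "- u"] TU by (simp add: power_minus_odd)
    qed (simp_all add: G_icosa_diagonal T)
  qed
qed (rule G_icosa_subset)

lemma card_G_icosa: "card (G_icosa \<epsilon>) = 120"
  unfolding G_icosa_eq using card_first_rows
  by (subst card_image) (auto simp: inj_on_def su_eq_iff)

end

section \<open>Sections and the action of SU(2)\<close>

lemma matrix_vector_mult_scale: "A *v (c *s v) = c *s (A *v v)" for A :: "complex^2^2"
  by (simp add: vec2_eq_iff mat2_vec_entry algebra_simps)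

lemma line_of_iff: "w \<in> line_of v \<longleftrightarrow> (\<exists>c. w = c *s v)"
  by (auto simp: line_of_def vec.span_singleton)

lemma line_of_scale:
  assumes "c \<noteq> 0"
  shows "line_of (c *s v) = line_of v"
proof -
  have "d *s v = (d / c) *s (c *s v)" "d *s (c *s v) = (d * c) *s v" for d
    using assms by (simp_all add: vec2_eq_iff)
  then show ?thesis by (auto simp only: set_eq_iff line_of_iff)
qed

lemma CP1_iff: "l \<in> CP1 \<longleftrightarrow> (\<exists>v. v \<noteq> 0 \<and> l = line_of v)"
proof
  assume "l \<in> CP1"
  then have l: "vec.subspace l" "vec.dim l = 1" by (auto simp: CP1_def)
  obtain S where S: "S \<subseteq> l" "vec.independent S" "l \<subseteq> vec.span S" "card S = 1"
    using vec.basis_exists[of l] l(2) by metis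
  then obtain v where v: "S = {v}" by (auto simp: card_1_singleton_iff)
  then have "v \<noteq> 0" "l = line_of v"
    using S l(1) vec.span_subspace[of S l] by (auto simp: line_of_def)
  then show "\<exists>v. v \<noteq> 0 \<and> l = line_of v" by blast
qed (auto simp: CP1_def line_of_def)

lemma act_line_line_of: "act_line g (line_of v) = line_of (g *v v)"
  by (auto simp: act_line_def line_of_def vec.span_singleton image_image matrix_vector_mult_scale)

lemma act_line_mult: "act_line (g ** h) l = act_line g (act_line h l)"
  by (simp add: act_line_def image_image matrix_vector_mul_assoc)

lemma act_line_one [simp]: "act_line (mat 1) l = l"
  by (simp add: act_line_def)

lemma act_line_cancel:
  assumes "g \<in> SU2"
  shows "act_line (matrix_inv g) (act_line g l) = l" "act_line g (act_line (matrix_inv g) l) = l"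
  by (simp_all flip: act_line_mult add: SU2_inverse_mult[OF assms])

lemma act_line_in_CP1:
  assumes "g \<in> SU2"
  shows "act_line g l \<in> CP1 \<longleftrightarrow> l \<in> CP1"
proof -
  have *: "act_line h l \<in> CP1" if h: "h \<in> SU2" and "l \<in> CP1" for h l
  proof -
    obtain v where v: "v \<noteq> 0" "l = line_of v" using \<open>l \<in> CP1\<close> by (auto simp: CP1_iff)
    have "matrix_inv h *v (h *v v) = v"
      by (simp add: matrix_vector_mul_assoc SU2_inverse_mult[OF h])
    then have "h *v v \<noteq> 0" using v(1) by (metis matrix_vector_mult_0_right)
    then show ?thesis using v(2) by (auto simp: act_line_line_of CP1_iff)
  qed
  show ?thesis
    using *[OF assms, of l] *[OF matrix_inv_in_SU2[OF assms], of "act_line g l"]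
    by (auto simp: act_line_cancel[OF assms])
qed

abbreviation base_line :: "(complex^2) set" where
  "base_line \<equiv> line_of (axis 1 1)"

lemma SU2_transitive:
  assumes "l \<in> CP1"
  obtains g where "g \<in> SU2" "l = act_line g base_line"
proof -
  obtain v where v: "v \<noteq> 0" "l = line_of v" using assms by (auto simp: CP1_iff)
  define r where "r = norm v"
  have r: "r \<noteq> 0" using v by (simp add: r_def)
  \<comment> \<open>These values make the first column of \<open>su a b\<close>, which is the image
    of the first basis vector, equal to v/r.\<close>
  define a b where "a = v $ 1 / r" and "b = - cnj (v $ 2) / r"
  have "v $ 1 * cnj (v $ 1) + v $ 2 * cnj (v $ 2) = of_real (r\<^sup>2)"
    by (simp add: r_def norm_vec_def L2_set_def sum_2 complex_norm_square[symmetric] 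
        del: of_real_power)
  then have "a * cnj a + b * cnj b = 1"
    using r by (simp add: a_def b_def field_simps power2_eq_square)
  then have g: "su a b \<in> SU2" by (rule su_in_SU2)
  have "su a b *v axis 1 1 = (1 / of_real r) *s v"
    by (simp add: vec2_eq_iff mat2_vec_entry axis_def a_def b_def)
  then have "act_line (su a b) base_line = line_of ((1 / of_real r) *s v)"
    by (simp add: act_line_line_of)
  also have "\<dots> = l"
    using r v(2) by (simp add: line_of_scale)
  finally show thesis using g that by auto
qed

section \<open>The action on sections\<close>

lemma act_sect_add: "act_sect g (s + t) = act_sect g s + act_sect g t"
  by (simp add: act_sect_def fun_eq_iff matrix_vector_mult_add_rdistrib matrix_vector_right_distrib)

lemma act_sect_scale: "act_sect g (sect_scale c s) = sect_scale c (act_sect g s)"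
  by (simp add: act_sect_def sect_scale_def matrix_vector_mult_scale)

lemma act_sect_zero: "act_sect g 0 = 0"
  by (simp add: act_sect_def fun_eq_iff)

lemma act_sect_sum: "act_sect g (\<Sum>i\<in>A. f i) = (\<Sum>i\<in>A. act_sect g (f i))"
  by (induction A rule: infinite_finite_induct) (simp_all only: act_sect_add act_sect_zero sum.infinite sum.empty sum.insert not_False_eq_True)

lemma act_sect_one [simp]: "act_sect (mat 1) s = s"
  using SU2_inverse_mult(1)[OF one_in_SU2] by (simp add: act_sect_def)

lemma act_sect_mult:
  assumes "g \<in> SU2" "h \<in> SU2"
  shows "act_sect (g ** h) s = act_sect g (act_sect h s)"
  by (simp add: act_sect_def fun_eq_iff matrix_inv_mult_SU2[OF assms] act_line_mult
      matrix_vector_mul_assoc)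

lemma act_sect_cancel:
  assumes "g \<in> SU2"
  shows "act_sect g (act_sect (matrix_inv g) s) = s"
  using act_sect_mult[OF assms matrix_inv_in_SU2[OF assms], of s] SU2_inverse_mult[OF assms] by simp

lemma sections_subspace: "sect.subspace sections"
proof -
  have "vec.subspace l" if "l \<in> CP1" for l
    using that by (simp add: CP1_def)
  then show ?thesis
    unfolding sect.subspace_def sections_def
    by (auto simp: sect_scale_def vec.subspace_0 vec.subspace_add vec.subspace_scale)
qed

lemma act_sect_in_sections:
  assumes "g \<in> SU2" "s \<in> sections"
  shows "act_sect g s \<in> sections"
proof -
  have "g *v s (act_line (matrix_inv g) l) \<in> l" if "l \<in> CP1" for l
  proof -
    have "s (act_line (matrix_inv g) l) \<in> act_line (matrix_inv g) l"
      using assms that by (simp add: sections_def act_line_in_CP1 matrix_inv_in_SU2)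
    then have "g *v s (act_line (matrix_inv g) l) \<in> act_line g (act_line (matrix_inv g) l)"
      by (auto simp: act_line_def)
    then show ?thesis by (simp add: act_line_cancel assms)
  qed
  then show ?thesis
    using assms by (simp add: sections_def act_sect_def act_line_in_CP1 matrix_inv_in_SU2)
qed

section \<open>Homogeneous polynomials\<close>

definition monom_fun :: "nat \<Rightarrow> nat \<Rightarrow> complex^2 \<Rightarrow> complex" where
  "monom_fun n j = (\<lambda>\<xi>. (\<xi> $ 1) ^ j * (\<xi> $ 2) ^ (n - j))"

lemma Sym_power_iff: "p \<in> Sym_power n \<longleftrightarrow> (\<exists>c. p = (\<lambda>\<xi>. \<Sum>j\<le>n. c j * monom_fun n j \<xi>))"
  by (simp add: Sym_power_def monom_fun_def mult.assoc)

lemma Sym_power_partial_sum: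
  assumes "A \<subseteq> {..n}"
  shows "(\<lambda>\<xi>. \<Sum>j\<in>A. c j * monom_fun n j \<xi>) \<in> Sym_power n"
proof -
  have "(\<Sum>j\<in>A. c j * monom_fun n j \<xi>) = (\<Sum>j\<le>n. (if j \<in> A then c j else 0) * monom_fun n j \<xi>)" for \<xi>
    using assms by (intro sum.mono_neutral_cong_left) auto
  then show ?thesis unfolding Sym_power_iff by auto
qed

lemma monom_fun_in_Sym_power: "j \<le> n \<Longrightarrow> monom_fun n j \<in> Sym_power n"
  using Sym_power_partial_sum[of "{j}" n "\<lambda>_. 1"] by simp

lemma Sym_power_add: "p \<in> Sym_power n \<Longrightarrow> q \<in> Sym_power n \<Longrightarrow> p + q \<in> Sym_power n"
proof -
  assume "p \<in> Sym_power n" "q \<in> Sym_power n"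
  then obtain c d where "p = (\<lambda>\<xi>. \<Sum>j\<le>n. c j * monom_fun n j \<xi>)"
    "q = (\<lambda>\<xi>. \<Sum>j\<le>n. d j * monom_fun n j \<xi>)"
    unfolding Sym_power_iff by blast
  then have "p + q = (\<lambda>\<xi>. \<Sum>j\<le>n. (c j + d j) * monom_fun n j \<xi>)"
    by (simp add: fun_eq_iff sum.distrib distrib_right)
  then show ?thesis unfolding Sym_power_iff by (intro exI)
qed

lemma Sym_power_scale: "p \<in> Sym_power n \<Longrightarrow> (\<lambda>\<xi>. a * p \<xi>) \<in> Sym_power n"
proof -
  assume "p \<in> Sym_power n"
  then obtain c where "p = (\<lambda>\<xi>. \<Sum>j\<le>n. c j * monom_fun n j \<xi>)"
    unfolding Sym_power_iff by blast
  then have "(\<lambda>\<xi>. a * p \<xi>) = (\<lambda>\<xi>. \<Sum>j\<le>n. (a * c j) * monom_fun n j \<xi>)"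
    by (simp add: sum_distrib_left mult.assoc)
  then show ?thesis unfolding Sym_power_iff by (intro exI)
qed

lemma Sym_power_sum:
  "(\<And>i. i \<in> A \<Longrightarrow> p i \<in> Sym_power n) \<Longrightarrow> (\<lambda>\<xi>. \<Sum>i\<in>A. p i \<xi>) \<in> Sym_power n"
proof (induction A rule: infinite_finite_induct)
  case (insert x A)
  then show ?case
    using Sym_power_add[of "p x" n "\<lambda>\<xi>. \<Sum>i\<in>A. p i \<xi>"] by (simp add: plus_fun_def)
qed (use Sym_power_partial_sum[of "{}" n] in auto)

lemma Sym_power_linear_factor:
  assumes "p \<in> Sym_power n"
  shows "(\<lambda>\<xi>. (a * \<xi> $ 1 + b * \<xi> $ 2) * p \<xi>) \<in> Sym_power (Suc n)"
proof -
  obtain c where p: "p = (\<lambda>\<xi>. \<Sum>j\<le>n. c j * monom_fun n j \<xi>)"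
    using assms unfolding Sym_power_iff by blast
  have "(\<lambda>\<xi>. (a * \<xi> $ 1 + b * \<xi> $ 2) * p \<xi>) = 
    (\<lambda>\<xi>. \<Sum>j\<le>n. a * c j * monom_fun (Suc n) (Suc j) \<xi> + b * c j * monom_fun (Suc n) j \<xi>)"
    by (simp add: p fun_eq_iff monom_fun_def sum_distrib_left Suc_diff_le algebra_simps)
  moreover have "(\<lambda>\<xi>. a * c j * monom_fun (Suc n) (Suc j) \<xi> + b * c j * monom_fun (Suc n) j \<xi>)
      \<in> Sym_power (Suc n)" if "j \<le> n" for j
    using that Sym_power_add[OF Sym_power_scale[OF monom_fun_in_Sym_power[of "Suc j" "Suc n"], of "a * c j"]
        Sym_power_scale[OF monom_fun_in_Sym_power[of j "Suc n"], of "b * c j"]]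
    by (simp add: plus_fun_def)
  then have "(\<lambda>\<xi>. \<Sum>j\<le>n. a * c j * monom_fun (Suc n) (Suc j) \<xi> + b * c j * monom_fun (Suc n) j \<xi>)
      \<in> Sym_power (Suc n)"
    by (intro Sym_power_sum) simp
  ultimately show ?thesis by simp
qed

text \<open>A linear substitution turns a monomial into a product of powers of two linear forms;
  this is what makes \<open>Sym_power\<close> stable under \<open>act_poly\<close>.\<close>

lemma Sym_power_linear_product:
  "(\<lambda>\<xi>. (a * \<xi> $ 1 + b * \<xi> $ 2) ^ i * (c * \<xi> $ 1 + d * \<xi> $ 2) ^ k) \<in> Sym_power (i + k)"
proof (induction i)
  case 0
  show ?case
  proof (induction k)
    case 0
    show ?case using monom_fun_in_Sym_power[of 0 0] by (simp add: monom_fun_def)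
  next
    case (Suc k)
    show ?case using Sym_power_linear_factor[OF Suc] by simp
  qed
next
  case (Suc i)
  show ?case using Sym_power_linear_factor[OF Suc] by (simp add: mult.assoc)
qed

lemma act_poly_in_Sym_power:
  assumes "p \<in> Sym_power n"
  shows "act_poly g p \<in> Sym_power n"
proof -
  obtain c where p: "p = (\<lambda>\<xi>. \<Sum>j\<le>n. c j * monom_fun n j \<xi>)"
    using assms unfolding Sym_power_iff by blast
  define q where "q j \<xi> = (g$1$1 * \<xi>$1 + g$2$1 * \<xi>$2) ^ j * (g$1$2 * \<xi>$1 + g$2$2 * \<xi>$2) ^ (n - j)"
    for j and \<xi> :: "complex^2"
  have "q j \<in> Sym_power n" if "j \<le> n" for j
    using that Sym_power_linear_product[of "g$1$1" "g$2$1" j "g$1$2" "g$2$2" "n - j"]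
    by (simp add: q_def[abs_def])
  then have "(\<lambda>\<xi>. \<Sum>j\<le>n. c j * q j \<xi>) \<in> Sym_power n"
    by (intro Sym_power_sum Sym_power_scale) auto
  moreover have "act_poly g p = (\<lambda>\<xi>. \<Sum>j\<le>n. c j * q j \<xi>)"
    by (simp add: act_poly_def p monom_fun_def mat2_vec_entry transpose_def q_def)
  ultimately show ?thesis by simp
qed

lemma linear_betw_Sym_power_sum:
  assumes f: "linear_betw (\<lambda>c p \<xi>. c * p \<xi>) scale2 (Sym_power n) W f"
    and A: "A \<subseteq> {..n}"
  shows "f (\<lambda>\<xi>. \<Sum>j\<in>A. c j * monom_fun n j \<xi>) = (\<Sum>j\<in>A. scale2 (c j) (f (monom_fun n j)))"
proof -
  have add: "f (p + q) = f p + f q" if "p \<in> Sym_power n" "q \<in> Sym_power n" for p q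
    using f that by (simp add: linear_betw_def)
  have scale: "f (\<lambda>\<xi>. a * p \<xi>) = scale2 a (f p)" if "p \<in> Sym_power n" for a p
    using f that by (simp add: linear_betw_def)
  have "finite A" using A finite_subset by blast
  then show ?thesis using A
  proof (induction A)
    case empty
    have "(\<lambda>_. 0) \<in> Sym_power n" using Sym_power_partial_sum[of "{}" n] by simp
    from add[OF this this] show ?case by (simp add: plus_fun_def)
  next
    case (insert x A)
    have "f (\<lambda>\<xi>. \<Sum>j\<in>insert x A. c j * monom_fun n j \<xi>)
        = f ((\<lambda>\<xi>. c x * monom_fun n x \<xi>) + (\<lambda>\<xi>. \<Sum>j\<in>A. c j * monom_fun n j \<xi>))"
      using insert by (simp add: plus_fun_def)
    also have "\<dots> = f (\<lambda>\<xi>. c x * monom_fun n x \<xi>) + f (\<lambda>\<xi>. \<Sum>j\<in>A. c j * monom_fun n j \<xi>)"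
      using insert Sym_power_partial_sum[of A n c] Sym_power_partial_sum[of "{x}" n c] by (intro add) auto
    finally show ?case
      using insert scale[OF monom_fun_in_Sym_power, of x] by simp
  qed
qed

section \<open>Multiplicity one\<close>

text \<open>One copy of S^n among the sections together with a chosen isomorphism. Its sections are
  studied through the values of \<open>\<phi> p\<close> at \<open>base_line\<close>, from which
  \<open>phi_translate\<close> recovers the values at all other lines.\<close>

locale sym_component =
  fixes n :: nat and W :: "sect set" and \<phi> :: "(complex^2 \<Rightarrow> complex) \<Rightarrow> sect"
  assumes sub: "W \<subseteq> sections"
    and bij: "bij_betw \<phi> (Sym_power n) W"
    and lin: "linear_betw (\<lambda>c p \<xi>. c * p \<xi>) sect_scale (Sym_power n) W \<phi>"
    and equiv: "\<And>g p. g \<in> SU2 \<Longrightarrow> p \<in> Sym_power n \<Longrightarrow> \<phi> (act_poly g p) = act_sect g (\<phi> p)"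
begin

lemma phi_add: "p \<in> Sym_power n \<Longrightarrow> q \<in> Sym_power n \<Longrightarrow> \<phi> (p + q) = \<phi> p + \<phi> q"
  using lin by (simp add: linear_betw_def)

lemma phi_scale: "p \<in> Sym_power n \<Longrightarrow> \<phi> (\<lambda>\<xi>. c * p \<xi>) = sect_scale c (\<phi> p)"
  using lin by (simp add: linear_betw_def)

lemma phi_in_W: "p \<in> Sym_power n \<Longrightarrow> \<phi> p \<in> W"
  using bij bij_betwE by blast

lemma W_E:
  assumes "s \<in> W"
  obtains p where "p \<in> Sym_power n" "s = \<phi> p"
  using assms bij unfolding bij_betw_def by blast

lemma phi_translate:
  assumes "g \<in> SU2" "p \<in> Sym_power n"
  shows "\<phi> p (act_line g l) = g *v \<phi> (act_poly (matrix_inv g) p) l"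
  using assms
  by (simp add: equiv matrix_inv_in_SU2 act_sect_def matrix_inv_matrix_inv_SU2 matrix_vector_mul_assoc
      SU2_inverse_mult)

lemma phi_off_CP1:
  assumes "l \<notin> CP1" "p \<in> Sym_power n"
  shows "\<phi> p l = 0"
  using assms phi_in_W sub by (auto simp: sections_def)

lemma phi_base_line:
  assumes "p \<in> Sym_power n"
  shows "\<phi> p base_line $ 2 = 0"
proof -
  have "base_line \<in> CP1" by (auto simp: CP1_iff axis_eq_0_iff intro!: exI[of _ "axis 1 1"])
  then have "\<phi> p base_line \<in> base_line"
    using phi_in_W[OF assms] sub by (auto simp: sections_def)
  then show ?thesis by (auto simp: line_of_iff axis_def)
qed

text \<open>The stabilizer of \<^term>\<open>base_line\<close> is the diagonal torus; only one monomial has the weight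
  with which the torus acts on the fiber.\<close>

lemma phi_monom_base_line:
  assumes "j \<le> n" "2 * j \<noteq> n + 1"
  shows "\<phi> (monom_fun n j) base_line = 0"
proof -
  \<comment> \<open>A single torus element suffices. The exponents to be compared are
    \<open>j\<close> and \<open>Suc (n - j)\<close>, both at most n + 1, so with this angle the
    arguments lie in [0, 1], where the cosine is injective.\<close>
  define t where "t = cis (1 / (n + 1))"
  have t: "t * cnj t = 1" by (simp add: t_def cis_cnj cis_mult)
  have D: "su t 0 \<in> SU2" using t by (intro su_in_SU2) simp
  have "act_line (su t 0) base_line = base_line"
  proof -
    have "su t 0 *v axis 1 1 = t *s axis 1 1"
      by (simp add: vec2_eq_iff mat2_vec_entry axis_def)
    moreover have "t \<noteq> 0" using t by auto
    ultimately show ?thesis by (simp add: act_line_line_of line_of_scale)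
  qed
  then have inv: "act_line (matrix_inv (su t 0)) base_line = base_line"
    using act_line_cancel(1)[OF D, of base_line] by simp
  define s where "s = \<phi> (monom_fun n j) base_line"
  have s2: "s $ 2 = 0" unfolding s_def by (intro phi_base_line monom_fun_in_Sym_power assms)
  have "act_poly (su t 0) (monom_fun n j) = (\<lambda>\<xi>. (t ^ j * cnj t ^ (n - j)) * monom_fun n j \<xi>)"
    by (simp add: act_poly_def monom_fun_def mat2_vec_entry transpose_def fun_eq_iff power_mult_distrib)
  then have "sect_scale (t ^ j * cnj t ^ (n - j)) (\<phi> (monom_fun n j)) = act_sect (su t 0) (\<phi> (monom_fun n j))"
    using equiv[OF D monom_fun_in_Sym_power] phi_scale[OF monom_fun_in_Sym_power] assms by metis
  then have "(t ^ j * cnj t ^ (n - j)) *s s = su t 0 *v s"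
    unfolding sect_scale_def act_sect_def s_def by (metis inv)
  then have s1: "t ^ j * cnj t ^ (n - j) * s $ 1 = t * s $ 1"
    using s2 by (simp add: vec2_eq_iff mat2_vec_entry)
  have "s $ 1 = 0"
  proof (rule ccontr)
    assume "s $ 1 \<noteq> 0"
    then have "t ^ j * cnj t ^ (n - j) = t" using s1 by simp
    then have "t ^ j * (cnj t ^ (n - j) * t ^ (n - j)) = t * t ^ (n - j)"
      by (metis mult.assoc)
    moreover have "cnj t ^ (n - j) * t ^ (n - j) = 1"
      using t by (simp add: mult.commute flip: power_mult_distrib)
    ultimately have "t ^ j = t ^ (Suc (n - j))" by simp
    then have "cis (j / (n + 1)) = cis (Suc (n - j) / (n + 1))"
      unfolding t_def Complex.DeMoivre by simp
    moreover define x y where "x = real j / (n + 1)" and "y = real (Suc (n - j)) / (n + 1)"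
    ultimately have "cos x = cos y" by (simp add: complex_eq_iff del: of_nat_Suc)
    moreover have "0 \<le> x" "x \<le> 1" "0 \<le> y" "y \<le> 1"
      using assms(1) by (simp_all add: x_def y_def divide_simps)
    ultimately have "x = y"
      using cos_inj_pi[of x y] pi_gt3 by simp
    then have "real j = real (Suc (n - j))" by (simp add: x_def y_def)
    then have "j = Suc (n - j)" by (simp only: of_nat_eq_iff)
    then show False using assms by simp
  qed
  then show ?thesis using s2 by (simp add: vec2_eq_iff flip: s_def)
qed

lemma phi_sum_base_line:
  assumes "n + 1 = 2 * k"
  shows "\<phi> (\<lambda>\<xi>. \<Sum>j\<le>n. c j * monom_fun n j \<xi>) base_line = c k *s \<phi> (monom_fun n k) base_line"
proof -
  have *: "(\<Sum>j\<in>A. sect_scale (c j) (\<phi> (monom_fun n j))) l = (\<Sum>j\<in>A. c j *s \<phi> (monom_fun n j) l)" for A l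
    by (induction A rule: infinite_finite_induct) (auto simp: sect_scale_def)
  have "\<phi> (\<lambda>\<xi>. \<Sum>j\<le>n. c j * monom_fun n j \<xi>) base_line = (\<Sum>j\<le>n. c j *s \<phi> (monom_fun n j) base_line)"
    unfolding linear_betw_Sym_power_sum[OF lin subset_refl] * ..
  also have "\<dots> = (\<Sum>j\<in>{k}. c j *s \<phi> (monom_fun n j) base_line)"
    using assms by (intro sum.mono_neutral_right) (auto simp: phi_monom_base_line)
  finally show ?thesis by simp
qed

text \<open>If the one surviving value were zero, every \<open>\<phi> p\<close> would vanish at
  \<open>base_line\<close> and then, by transitivity, everywhere, against injectivity of
  \<open>\<phi>\<close>.\<close>

lemma phi_monom_base_line_nonzero:
  assumes "n + 1 = 2 * k"
  shows "\<phi> (monom_fun n k) base_line $ 1 \<noteq> 0"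
proof
  assume "\<phi> (monom_fun n k) base_line $ 1 = 0"
  moreover have k: "k \<le> n" using assms by simp
  ultimately have "\<phi> (monom_fun n k) base_line = 0"
    using phi_base_line[OF monom_fun_in_Sym_power] by (simp add: vec2_eq_iff)
  then have base: "\<phi> p base_line = 0" if "p \<in> Sym_power n" for p
    using that phi_sum_base_line[OF assms] unfolding Sym_power_iff by auto
  have "\<phi> p l = 0" if p: "p \<in> Sym_power n" for p l
  proof (cases "l \<in> CP1")
    case True
    then obtain g where "g \<in> SU2" "l = act_line g base_line" by (rule SU2_transitive)
    then show ?thesis using p base by (simp add: phi_translate act_poly_in_Sym_power)
  qed (use phi_off_CP1 p in auto)
  moreover have "(\<lambda>_. 0) \<in> Sym_power n" using Sym_power_partial_sum[of "{}" n] by simp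
  ultimately have "\<phi> (monom_fun n k) = \<phi> (\<lambda>_. 0)"
    using monom_fun_in_Sym_power[OF k] by (simp add: fun_eq_iff)
  then have "monom_fun n k = (\<lambda>_. 0)"
    using bij monom_fun_in_Sym_power[OF k] \<open>(\<lambda>_. 0) \<in> Sym_power n\<close> by (meson bij_betw_def inj_onD)
  then have "monom_fun n k (\<chi> i. 1) = 0" by simp
  then show False by (simp add: monom_fun_def)
qed

end

text \<open>At \<open>base_line\<close> both isomorphisms read off the same coefficient, the k-th,
  up to the nonzero scalar \<open>a\<close> and the scalar \<open>a'\<close>. So \<phi>' = (a'/a)
  \<phi> there, and by translation at every line.\<close>

lemma sym_component_subset:
  assumes "sym_component n W \<phi>" "sym_component n W' \<phi>'" "n + 1 = 2 * k"
  shows "W' \<subseteq> W"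
proof -
  interpret c: sym_component n W \<phi> by fact
  interpret c': sym_component n W' \<phi>' by fact
  define a a' where "a = \<phi> (monom_fun n k) base_line $ 1" and "a' = \<phi>' (monom_fun n k) base_line $ 1"
  have k: "k \<le> n" using assms(3) by simp
  have a: "a \<noteq> 0"
    unfolding a_def by (intro c.phi_monom_base_line_nonzero assms)
  have base: "\<phi>' p base_line = (a' / a) *s \<phi> p base_line" if "p \<in> Sym_power n" for p
  proof -
    have "\<phi>' (monom_fun n k) base_line = (a' / a) *s \<phi> (monom_fun n k) base_line"
      using a c.phi_base_line[OF monom_fun_in_Sym_power[OF k]]
        c'.phi_base_line[OF monom_fun_in_Sym_power[OF k]]
      by (simp add: vec2_eq_iff a_def a'_def)
    then show ?thesis
      using that c.phi_sum_base_line[OF assms(3)] c'.phi_sum_base_line[OF assms(3)]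
      unfolding Sym_power_iff by (auto simp: mult.commute)
  qed
  have "\<phi>' p l = (a' / a) *s \<phi> p l" if p: "p \<in> Sym_power n" for p l
  proof (cases "l \<in> CP1")
    case True
    then obtain g where "g \<in> SU2" "l = act_line g base_line" by (rule SU2_transitive)
    then show ?thesis
      using p base
      by (simp add: c.phi_translate c'.phi_translate act_poly_in_Sym_power matrix_vector_mult_scale)
  qed (use p c.phi_off_CP1 c'.phi_off_CP1 in auto)
  then have "\<phi>' p = \<phi> (\<lambda>\<xi>. (a' / a) * p \<xi>)" if "p \<in> Sym_power n" for p
    using that by (subst c.phi_scale[OF that]) (simp add: fun_eq_iff sect_scale_def)
  then show ?thesis
    using c'.W_E c.phi_in_W Sym_power_scale by (metis subsetI)
qed

text \<open>Any two copies contain each other, so their span is a single copy. The first alternative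
  is the one in which there is no copy at all and the span is that of the empty set.\<close>

lemma Gamma_comp_cases:
  assumes "1 \<le> k"
  obtains "Gamma_comp (2 * k) = {0}"
  | \<phi> where "sym_component (2 * k - 1) (Gamma_comp (2 * k)) \<phi>"
proof -
  define \<W> where "\<W> = {W. W \<subseteq> L2_sections \<inter> continuous_sections \<and> sect.subspace W \<and>
     (\<forall>g\<in>SU2. \<forall>s\<in>W. act_sect g s \<in> W) \<and> iso_to_Sym_power (2 * k - 1) W}"
  have Gamma: "Gamma_comp (2 * k) = sect.span (\<Union>\<W>)"
    by (simp add: Gamma_comp_def \<W>_def)
  have comp: "\<exists>\<phi>. sym_component (2 * k - 1) W \<phi>" if "W \<in> \<W>" for W
    using that unfolding \<W>_def iso_to_Sym_power_def sym_component_def L2_sections_def by blast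
  show thesis
  proof (cases "\<W> = {}")
    case True
    then show thesis using Gamma that(1) by simp
  next
    case False
    then obtain W \<phi> where W: "W \<in> \<W>" "sym_component (2 * k - 1) W \<phi>"
      using comp by blast
    have "W' = W" if W': "W' \<in> \<W>" for W'
    proof -
      obtain \<phi>' where \<phi>': "sym_component (2 * k - 1) W' \<phi>'" using comp[OF W'] by blast
      have "2 * k - 1 + 1 = 2 * k" using assms by simp
      then show ?thesis
        using sym_component_subset[OF W(2) \<phi>'] sym_component_subset[OF \<phi>' W(2)] by blast
    qed
    then have "\<W> = {W}" using W(1) by blast
    moreover have "sect.subspace W" using W(1) by (simp add: \<W>_def)
    ultimately have "Gamma_comp (2 * k) = W"
      using Gamma by (simp add: sect.span_eq_iff)
    then show thesis using that(2) W(2) by blast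
  qed
qed

section \<open>Equivariant maps into the standard representation\<close>

text \<open>The unknowns are the 2 (n + 1) coordinates of the images of the monomials, and each
  generator contributes linear equations between them.\<close>

locale icosa_equivariant = fifth_root +
  fixes n :: nat and f :: "(complex^2 \<Rightarrow> complex) \<Rightarrow> complex^2"
  assumes f_lin: "linear_betw (\<lambda>c p \<xi>. c * p \<xi>) (*s) (Sym_power n) UNIV f"
    and f_equiv: "\<And>g p. g \<in> {icosa_S \<epsilon>, icosa_T \<epsilon>, icosa_U} \<Longrightarrow> p \<in> Sym_power n \<Longrightarrow>
      f (act_poly g p) = g *v f p"
begin

abbreviation fm :: "nat \<Rightarrow> complex^2" where "fm j \<equiv> f (monom_fun n j)"

lemma eps_power_eqD:
  assumes "\<epsilon> ^ a = \<epsilon> ^ b" "b < 5"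
  shows "a mod 5 = b"
proof -
  define r where "r = a mod 5"
  have r: "r < 5" by (simp add: r_def)
  have "\<epsilon> ^ a = \<epsilon> ^ (5 * (a div 5)) * \<epsilon> ^ r"
    unfolding r_def power_add[symmetric] by simp
  then have eq: "\<epsilon> ^ r = \<epsilon> ^ b"
    using assms eps_power_eq_1[of "5 * (a div 5)"] by simp
  have no: "\<not> (0 < k \<and> k < 5 \<and> \<epsilon> ^ k = 1)" for k
    using primitive by (auto simp: primitive_root_of_unity_def)
  have "\<epsilon> ^ (r - b) = 1" if "b < r"
    using that eq eps_ne power_add[of \<epsilon> "r - b" b] by simp
  moreover have "\<epsilon> ^ (b - r) = 1" if "r < b"
    using that eq eps_ne power_add[of \<epsilon> "b - r" r] by simp
  ultimately have "r = b"
    using no[of "r - b"] no[of "b - r"] r assms(2) by (cases r b rule: linorder_cases) auto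
  then show ?thesis by (simp add: r_def)
qed

lemma f_scale: "p \<in> Sym_power n \<Longrightarrow> f (\<lambda>\<xi>. c * p \<xi>) = c *s f p"
  using f_lin by (simp add: linear_betw_def)

text \<open>S is diagonal on both sides: it scales the j-th monomial by a power of
  \<open>\<epsilon>\<close>, and the two coordinates of C^2 by \<open>\<epsilon> ^ 3\<close> and
  \<open>\<epsilon> ^ 2\<close>. A coordinate of the image survives only if these exponents agree
  modulo 5.\<close>

lemma S_weight:
  assumes "j \<le> n"
  shows "(3 * j + 2 * (n - j)) mod 5 \<noteq> 3 \<Longrightarrow> fm j $ 1 = 0"
    "(3 * j + 2 * (n - j)) mod 5 \<noteq> 2 \<Longrightarrow> fm j $ 2 = 0"
proof -
  let ?w = "3 * j + 2 * (n - j)"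
  have "cnj (\<epsilon> ^ 3) = \<epsilon> ^ 2"
    using eps5 by (simp add: cnj_eps) algebra
  then have S: "icosa_S \<epsilon> $ 1 $ 1 = \<epsilon> ^ 3" "icosa_S \<epsilon> $ 1 $ 2 = 0"
    "icosa_S \<epsilon> $ 2 $ 1 = 0" "icosa_S \<epsilon> $ 2 $ 2 = \<epsilon> ^ 2"
    by (simp_all add: icosa_generators_eq)
  have "act_poly (icosa_S \<epsilon>) (monom_fun n j) = (\<lambda>\<xi>. \<epsilon> ^ ?w * monom_fun n j \<xi>)"
    by (simp add: act_poly_def monom_fun_def mat2_vec_entry transpose_def fun_eq_iff
        power_mult_distrib S power_add power_mult)
  then have "\<epsilon> ^ ?w *s fm j = icosa_S \<epsilon> *v fm j"
    using f_equiv[of "icosa_S \<epsilon>" "monom_fun n j"] f_scale[of "monom_fun n j"]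
      monom_fun_in_Sym_power[OF assms] by simp
  then have "\<epsilon> ^ ?w * fm j $ 1 = \<epsilon> ^ 3 * fm j $ 1" "\<epsilon> ^ ?w * fm j $ 2 = \<epsilon> ^ 2 * fm j $ 2"
    by (simp_all add: vec2_eq_iff mat2_vec_entry S)
  then show "?w mod 5 \<noteq> 3 \<Longrightarrow> fm j $ 1 = 0" "?w mod 5 \<noteq> 2 \<Longrightarrow> fm j $ 2 = 0"
    using eps_power_eqD[of ?w 3] eps_power_eqD[of ?w 2] by auto
qed

lemma U_symmetry:
  assumes "j \<le> n"
  shows "(- 1) ^ j * fm (n - j) $ 1 = fm j $ 2" "(- 1) ^ j * fm (n - j) $ 2 = - fm j $ 1"
proof -
  have "act_poly icosa_U (monom_fun n j) = (\<lambda>\<xi>. (- 1) ^ j * monom_fun n (n - j) \<xi>)"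
    using assms
    by (simp add: act_poly_def monom_fun_def mat2_vec_entry transpose_def fun_eq_iff
        power_minus[of "_ $ 2"] icosa_generators_eq mult_ac)
  then have "(- 1) ^ j *s fm (n - j) = icosa_U *v fm j"
    using f_equiv[of icosa_U "monom_fun n j"] f_scale[of "monom_fun n (n - j)"]
      monom_fun_in_Sym_power[of _ n] assms by simp
  then show "(- 1) ^ j * fm (n - j) $ 1 = fm j $ 2" "(- 1) ^ j * fm (n - j) $ 2 = - fm j $ 1"
    by (simp_all add: vec2_eq_iff mat2_vec_entry icosa_generators_eq)
qed

text \<open>Both sides are coordinates of the image under \<open>f\<close> of T applied to the pure
  power. T turns that power into the n-th power of B (\<alpha> x + y), in which every monomial has a
  nonzero coefficient, so no unknown drops out.\<close>

lemma T_relation: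
  "B ^ n * (\<Sum>k\<le>n. of_nat (n choose k) * \<alpha> ^ k * fm k $ 1) = B * (\<alpha> * fm n $ 1 + fm n $ 2)"
  "B ^ n * (\<Sum>k\<le>n. of_nat (n choose k) * \<alpha> ^ k * fm k $ 2) = B * (fm n $ 1 - \<alpha> * fm n $ 2)"
proof -
  have "act_poly (icosa_T \<epsilon>) (monom_fun n n) = (\<lambda>\<xi>. (B * (\<alpha> * \<xi> $ 1 + \<xi> $ 2)) ^ n)"
    by (simp add: act_poly_def monom_fun_def mat2_vec_entry transpose_def fun_eq_iff
        icosa_generators_eq cnj_constants algebra_simps)
  also have "\<dots> = (\<lambda>\<xi>. \<Sum>k\<le>n. (B ^ n * (of_nat (n choose k) * \<alpha> ^ k)) * monom_fun n k \<xi>)"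
    by (simp add: power_mult_distrib binomial_ring monom_fun_def sum_distrib_left mult_ac)
  finally have "(\<Sum>k\<le>n. (B ^ n * (of_nat (n choose k) * \<alpha> ^ k)) *s fm k) = icosa_T \<epsilon> *v fm n"
    using f_equiv[of "icosa_T \<epsilon>" "monom_fun n n"] monom_fun_in_Sym_power[of n n]
      linear_betw_Sym_power_sum[OF f_lin subset_refl] by simp
  then show "B ^ n * (\<Sum>k\<le>n. of_nat (n choose k) * \<alpha> ^ k * fm k $ 1) = B * (\<alpha> * fm n $ 1 + fm n $ 2)"
    "B ^ n * (\<Sum>k\<le>n. of_nat (n choose k) * \<alpha> ^ k * fm k $ 2) = B * (fm n $ 1 - \<alpha> * fm n $ 2)"
    by (simp_all add: vec2_eq_iff mat2_vec_entry icosa_generators_eq cnj_constants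
        sum_distrib_left mult.assoc algebra_simps)
qed

lemma f_eq_0:
  assumes "\<And>j. j \<le> n \<Longrightarrow> fm j = 0" "p \<in> Sym_power n"
  shows "f p = 0"
proof -
  obtain c where "p = (\<lambda>\<xi>. \<Sum>j\<le>n. c j * monom_fun n j \<xi>)"
    using assms(2) unfolding Sym_power_iff by blast
  then show ?thesis
    using linear_betw_Sym_power_sum[OF f_lin subset_refl, of c] assms(1) by simp
qed

text \<open>The weight of the j-th monomial is 2n + j. Modulo 5 it admits a first coordinate only at
  j = k = (n + 1)/2 and a second one only at k - 1, because n < 9 leaves no room for a shift by 5.
  Hence \<open>fm n\<close> is zero, the right-hand sides of \<open>T_relation\<close> vanish, and
  each left-hand side is a nonzero multiple of one unknown.\<close>

lemma equivariant_3_5_7: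
  assumes "n \<in> {3, 5, 7}" "p \<in> Sym_power n"
  shows "f p = 0"
proof -
  define k where "k = (n + 1) div 2"
  have k: "k \<le> n" "k - 1 \<le> n" "k \<noteq> n" using assms(1) by (auto simp: k_def)
  have first: "fm j $ 1 = 0" if "j \<le> n" "j \<noteq> k" for j
  proof (rule S_weight(1))
    have "j \<in> {0, 1, 2, 3, 4, 5, 6, 7}" using that assms(1) by auto
    then show "(3 * j + 2 * (n - j)) mod 5 \<noteq> 3"
      using that assms(1) unfolding k_def by auto
  qed (use that in simp)
  have second: "fm j $ 2 = 0" if "j \<le> n" "j \<noteq> k - 1" for j
  proof (rule S_weight(2))
    have "j \<in> {0, 1, 2, 3, 4, 5, 6, 7}" using that assms(1) by auto
    then show "(3 * j + 2 * (n - j)) mod 5 \<noteq> 2"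
      using that assms(1) unfolding k_def by auto
  qed (use that in simp)
  have fmn: "fm n $ 1 = 0" "fm n $ 2 = 0"
    using first second k by auto
  have "(\<Sum>i\<le>n. of_nat (n choose i) * \<alpha> ^ i * fm i $ 1) = (\<Sum>i\<in>{k}. of_nat (n choose i) * \<alpha> ^ i * fm i $ 1)"
    using k first by (intro sum.mono_neutral_right) auto
  then have "fm k $ 1 = 0"
    using T_relation(1) fmn alpha_ne k by simp
  then have first': "fm j $ 1 = 0" if "j \<le> n" for j
    using first that by (cases "j = k") auto
  have "(\<Sum>i\<le>n. of_nat (n choose i) * \<alpha> ^ i * fm i $ 2) = (\<Sum>i\<in>{k - 1}. of_nat (n choose i) * \<alpha> ^ i * fm i $ 2)"
    using k second by (intro sum.mono_neutral_right) auto
  then have "fm (k - 1) $ 2 = 0"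
    using T_relation(2) fmn alpha_ne k by simp
  then have "fm j $ 2 = 0" if "j \<le> n" for j
    using second that by (cases "j = k - 1") auto
  with first' have "fm j = 0" if "j \<le> n" for j
    using that by (simp add: vec2_eq_iff)
  then show ?thesis using f_eq_0 assms(2) by blast
qed

text \<open>Here the weights repeat with period 5 inside the range: first coordinates survive at 0
  and 5, second ones at 4 and 9. The symmetry under U identifies them in pairs up to sign, and the
  two relations from T form a regular system for the remaining \<open>a\<close> and
  \<open>b\<close>.\<close>

lemma equivariant_9:
  assumes n: "n = 9" and "p \<in> Sym_power n"
  shows "f p = 0"
proof -
  have first: "fm j $ 1 = 0" if "j \<le> 9" "j \<notin> {0, 5}" for j
  proof (rule S_weight(1))
    have "j \<in> {1, 2, 3, 4, 6, 7, 8, 9}" using that by auto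
    then show "(3 * j + 2 * (n - j)) mod 5 \<noteq> 3" unfolding n by auto
  qed (use that n in simp)
  have second: "fm j $ 2 = 0" if "j \<le> 9" "j \<notin> {4, 9}" for j
  proof (rule S_weight(2))
    have "j \<in> {0, 1, 2, 3, 5, 6, 7, 8}" using that by auto
    then show "(3 * j + 2 * (n - j)) mod 5 \<noteq> 2" unfolding n by auto
  qed (use that n in simp)
  define a b where "a = fm 5 $ 1" and "b = fm 0 $ 1"
  have ab: "fm 9 $ 2 = - b" "fm 4 $ 2 = a" "fm 9 $ 1 = 0"
    using U_symmetry(2)[of 0] U_symmetry(2)[of 5] first[of 9] n by (simp_all add: a_def b_def)
  have binom: "(9::nat) choose 5 = 126" "(9::nat) choose 4 = 126"
    by (simp_all add: eval_nat_numeral)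
  have "(\<Sum>k\<le>9. of_nat (9 choose k) * \<alpha> ^ k * fm k $ 1) = (\<Sum>k\<in>{0, 5}. of_nat (9 choose k) * \<alpha> ^ k * fm k $ 1)"
    using first by (intro sum.mono_neutral_right) auto
  then have 1: "B ^ 9 * (b + 126 * \<alpha> ^ 5 * a) = - (B * b)"
    using T_relation(1) n ab binom by (simp add: a_def b_def)
  have "(\<Sum>k\<le>9. of_nat (9 choose k) * \<alpha> ^ k * fm k $ 2) = (\<Sum>k\<in>{4, 9}. of_nat (9 choose k) * \<alpha> ^ k * fm k $ 2)"
    using second by (intro sum.mono_neutral_right) auto
  then have 2: "B ^ 9 * (126 * \<alpha> ^ 4 * a - \<alpha> ^ 9 * b) = B * (\<alpha> * b)"
    using T_relation(2) n ab binom by simp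
  \<comment> \<open>Multiplication by \<open>\<beta> ^ 9\<close> clears the powers of B = 1/\<beta>
    and leaves \<open>\<beta> ^ 8\<close>, which is linear in \<open>\<alpha>\<close>.\<close>
  have strip: "x = \<beta> ^ 8 * y" if "B ^ 9 * x = B * y" for x y
  proof -
    have "\<beta> ^ 9 * (B ^ 9 * x) = \<beta> ^ 9 * (B * y)" using that by simp
    moreover have "\<beta> ^ 9 * B ^ 9 = 1" "\<beta> ^ 9 * B = \<beta> ^ 8"
      using alpha_ne(2) by (simp_all add: B_def power_one_over power_numeral_reduce)
    ultimately show ?thesis by (simp flip: mult.assoc)
  qed
  have e1: "b + 126 * \<alpha> ^ 5 * a = - (\<beta> ^ 8 * b)" and e2: "126 * \<alpha> ^ 4 * a - \<alpha> ^ 9 * b = \<beta> ^ 8 * (\<alpha> * b)"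
    using strip[of _ "- b"] strip[OF 2] 1 by simp_all
  have b8: "\<beta> ^ 8 = 50 - 75 * \<alpha>"
    using beta_sq alpha_sq by algebra
  \<comment> \<open>Eliminating \<open>a\<close> between \<open>e1\<close> and
    \<open>\<alpha>\<close> times \<open>e2\<close> gives b (1 + \<alpha>^10 + \<beta>^8 (1 +
    \<alpha>^2)) = 0; reduction by \<alpha>^2 = 1 - \<alpha> turns the bracket into 210 - 330
    \<alpha>.\<close>
  have "b * (210 - 330 * \<alpha>) = 0"
    using e1 e2 unfolding b8 using alpha_sq by algebra
  moreover have "210 - 330 * \<alpha> \<noteq> 0"
    using rational_not_alpha_root[of 330 210] by auto
  ultimately have b: "b = 0" by simp
  then have a: "a = 0"
    using e1 alpha_ne by simp
  have "fm j $ 1 = 0" if "j \<le> n" for j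
    using that first[of j] a b n unfolding a_def b_def by (cases "j \<in> {0, 5}") auto
  moreover have "fm j $ 2 = 0" if "j \<le> n" for j
    using that second[of j] a b ab n by (cases "j \<in> {4, 9}") auto
  ultimately have "fm j = 0" if "j \<le> n" for j
    using that by (simp add: vec2_eq_iff)
  then show ?thesis using f_eq_0 assms(2) by blast
qed

text \<open>The weights of S remove the off-diagonal entries and U equates the diagonal ones, so
  \<open>f\<close> is a scalar matrix.\<close>

lemma equivariant_1:
  assumes "n = 1"
  shows "fm 1 $ 2 = 0" "fm 0 $ 1 = 0" "fm 0 $ 2 = fm 1 $ 1"
  using assms S_weight(2)[of 1] S_weight(1)[of 0] U_symmetry(2)[of 1] by auto

end

section \<open>Averaging a design over the icosahedral group\<close>

lemma Gamma_comp_subspace: "sect.subspace (Gamma_comp d)"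
  by (simp add: Gamma_comp_def)

lemma Gamma_comp_sections: "Gamma_comp d \<subseteq> sections"
  unfolding Gamma_comp_def
  by (intro sect.span_minimal sections_subspace) (auto simp: L2_sections_def)

lemma act_sect_Gamma_comp:
  assumes "g \<in> SU2" "s \<in> Gamma_comp d"
  shows "act_sect g s \<in> Gamma_comp d"
proof -
  let ?U = "\<Union>{W. W \<subseteq> L2_sections \<inter> continuous_sections \<and> sect.subspace W \<and>
     (\<forall>g\<in>SU2. \<forall>s\<in>W. act_sect g s \<in> W) \<and> iso_to_Sym_power (d - 1) W}"
  have "sect.subspace {s. act_sect g s \<in> Gamma_comp d}"
    using Gamma_comp_subspace[of d] act_sect_zero
    by (auto simp: sect.subspace_def act_sect_add act_sect_scale simp del: zero_fun_def)
  moreover have "?U \<subseteq> {s. act_sect g s \<in> Gamma_comp d}"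
    using assms(1) sect.span_superset[of ?U] unfolding Gamma_comp_def by blast
  ultimately have "sect.span ?U \<subseteq> {s. act_sect g s \<in> Gamma_comp d}"
    by (intro sect.span_minimal)
  then show ?thesis using assms(2) unfolding Gamma_comp_def by blast
qed

lemma H_space_sections: "H_space \<subseteq> sections"
  unfolding H_space_def using Gamma_comp_sections
  by (intro sect.span_minimal sections_subspace) blast

section \<open>The trace of a map of rank at most two\<close>

lemma functional_sum:
  assumes "\<And>s t. s \<in> sections \<Longrightarrow> t \<in> sections \<Longrightarrow> L (s + t) = L s + L t"
    and "\<And>c s. s \<in> sections \<Longrightarrow> L (sect_scale c s) = c * L s"
    and "finite F" "F \<subseteq> sections"
  shows "L (\<Sum>b\<in>F. sect_scale (r b) b) = (\<Sum>b\<in>F. r b * L b :: complex)"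
  using assms(3,4)
proof (induction F)
  case empty
  have "(0::sect) \<in> sections" using sections_subspace sect.subspace_0 by blast
  from assms(2)[OF this, of 0] have "L 0 = 0" by (simp only: sect.scale_zero_left mult_zero_left)
  then show ?case by (simp only: sum.empty)
next
  case (insert b F)
  then have "sect_scale (r b) b \<in> sections" "(\<Sum>b\<in>F. sect_scale (r b) b) \<in> sections"
    using sections_subspace by (auto intro!: sect.subspace_scale sect.subspace_sum)
  then show ?case
    using insert assms(1,2) by (simp only: sum.insert insert_subset simp_thms)
qed

text \<open>The map is a sum of two operators of the form s -> L(s) w, and such an operator has
  trace L(w): expand w in the basis and apply L.\<close>

lemma sect_trace_rank_two:
  assumes V: "sect.subspace V" "V \<subseteq> sections"
    and w: "w1 \<in> V" "w2 \<in> V"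
    and f: "\<And>s. s \<in> V \<Longrightarrow> f s = sect_scale (L1 s) w1 + sect_scale (L2 s) w2"
    and L1: "\<And>s t. s \<in> sections \<Longrightarrow> t \<in> sections \<Longrightarrow> L1 (s + t) = L1 s + L1 t"
      "\<And>c s. s \<in> sections \<Longrightarrow> L1 (sect_scale c s) = c * L1 s"
    and L2: "\<And>s t. s \<in> sections \<Longrightarrow> t \<in> sections \<Longrightarrow> L2 (s + t) = L2 s + L2 t"
      "\<And>c s. s \<in> sections \<Longrightarrow> L2 (sect_scale c s) = c * L2 s"
    and nz: "sect_trace V f \<noteq> 0"
  shows "sect_trace V f = L1 w1 + L2 w2"
proof -
  define B where "B = (SOME B. \<not> sect.dependent B \<and> sect.span B = V)"
  obtain B0 where B0: "B0 \<subseteq> V" "\<not> sect.dependent B0" "V \<subseteq> sect.span B0"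
    by (rule sect.maximal_independent_subset)
  then have "\<not> sect.dependent B0 \<and> sect.span B0 = V"
    using sect.span_minimal[OF B0(1) V(1)] by blast
  then have "\<not> sect.dependent B \<and> sect.span B = V"
    unfolding B_def by (rule someI)
  then have B: "\<not> sect.dependent B" "sect.span B = V" by auto
  have BV: "B \<subseteq> V" using B(2) sect.span_superset by blast
  have tr: "sect_trace V f = (\<Sum>b\<in>B. sect.representation B (f b) b)"
    unfolding sect_trace_def B_def Let_def ..
  \<comment> \<open>A sum over an infinite set is 0 by convention, so a nonzero trace excludes an
    infinite basis.\<close>
  have fin: "finite B" using nz unfolding tr by (rule contrapos_np) (rule sum.infinite)
  have L: "(\<Sum>b\<in>B. sect.representation B w b * L b) = L w"
    if "w \<in> V" "\<And>s t. s \<in> sections \<Longrightarrow> t \<in> sections \<Longrightarrow> L (s + t) = L s + L t"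
      "\<And>c s. s \<in> sections \<Longrightarrow> L (sect_scale c s) = c * L s" for w and L :: "sect \<Rightarrow> complex"
  proof -
    have "L (\<Sum>b\<in>B. sect_scale (sect.representation B w b) b)
        = (\<Sum>b\<in>B. sect.representation B w b * L b)"
      using BV V(2) by (intro functional_sum that(2,3) fin) blast+
    moreover have "w \<in> sect.span B" using that(1) B(2) by simp
    ultimately show ?thesis
      by (simp only: sect.sum_representation_eq[OF B(1) _ fin subset_refl])
  qed
  have "sect.representation B (f b) b
      = sect.representation B w1 b * L1 b + sect.representation B w2 b * L2 b" if "b \<in> B" for b
  proof -
    have "f b = sect_scale (L1 b) w1 + sect_scale (L2 b) w2" using f that BV by blast
    moreover have sp: "w1 \<in> sect.span B" "w2 \<in> sect.span B"
        "sect_scale (L1 b) w1 \<in> sect.span B" "sect_scale (L2 b) w2 \<in> sect.span B"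
      using w B(2) by (auto intro: sect.span_scale)
    ultimately show ?thesis
      by (simp only: sect.representation_add[OF B(1) sp(4,3)] sect.representation_scale[OF B(1) sp(1)]
          sect.representation_scale[OF B(1) sp(2)] mult.commute)
  qed
  then show ?thesis
    unfolding tr using L[OF w(1) L1] L[OF w(2) L2] by (simp add: sum.distrib)
qed

section \<open>The averaged map and the orbit sum of a design\<close>

locale icosa_design = fifth_root +
  fixes X :: "(complex^2) set set" and lam :: "(complex^2) set \<Rightarrow> complex^2 \<Rightarrow> sect"
  assumes design: "design_data X lam"
begin

abbreviation G :: "(complex^2^2) set" where "G \<equiv> G_icosa \<epsilon>"

definition avg :: "sect \<Rightarrow> sect" where
  "avg s = sect_scale (1 / 120) (\<Sum>g\<in>G. act_sect g (Psi X lam (act_sect (matrix_inv g) s)))"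

lemma finite_G: "finite G"
  using card_G_icosa card_ge_0_finite by force

lemma G_SU2: "g \<in> G \<Longrightarrow> g \<in> SU2"
  using G_icosa_SU2 by blast

lemma design_props:
  shows "finite X" "X \<subseteq> CP1"
    and "x \<in> X \<Longrightarrow> v \<in> x \<Longrightarrow> lam x v \<in> Gamma_comp 2"
    and "x \<in> X \<Longrightarrow> v \<in> x \<Longrightarrow> w \<in> x \<Longrightarrow> lam x (v + w) = lam x v + lam x w"
    and "x \<in> X \<Longrightarrow> v \<in> x \<Longrightarrow> lam x (c *s v) = sect_scale c (lam x v)"
  using design unfolding design_data_def linear_betw_def by blast+

lemma section_value: "s \<in> sections \<Longrightarrow> x \<in> X \<Longrightarrow> s x \<in> x"
  using design_props(2) by (auto simp: sections_def)

lemma Psi_Gamma: "s \<in> sections \<Longrightarrow> Psi X lam s \<in> Gamma_comp 2"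
  unfolding Psi_def
  by (intro sect.subspace_sum Gamma_comp_subspace design_props section_value)

lemma Psi_add: "s \<in> sections \<Longrightarrow> t \<in> sections \<Longrightarrow> Psi X lam (s + t) = Psi X lam s + Psi X lam t"
  unfolding Psi_def sum.distrib[symmetric]
  by (intro sum.cong refl) (simp only: plus_fun_apply design_props(4) section_value)

lemma Psi_scale: "s \<in> sections \<Longrightarrow> Psi X lam (sect_scale c s) = sect_scale c (Psi X lam s)"
  unfolding Psi_def sect.scale_sum_right
  by (intro sum.cong refl) (simp only: sect_scale_def[of c s] design_props(5) section_value)

lemma act_sections: "g \<in> G \<Longrightarrow> s \<in> sections \<Longrightarrow> act_sect (matrix_inv g) s \<in> sections"
  by (intro act_sect_in_sections matrix_inv_in_SU2 G_SU2)

lemma avg_Gamma: "s \<in> sections \<Longrightarrow> avg s \<in> Gamma_comp 2"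
  unfolding avg_def
  by (intro sect.subspace_scale sect.subspace_sum Gamma_comp_subspace act_sect_Gamma_comp G_SU2
      Psi_Gamma act_sections)

lemma avg_add: "s \<in> sections \<Longrightarrow> t \<in> sections \<Longrightarrow> avg (s + t) = avg s + avg t"
  unfolding avg_def sect.scale_right_distrib[symmetric] sum.distrib[symmetric]
  by (intro arg_cong[of _ _ "sect_scale _"] sum.cong refl) (simp only: act_sect_add Psi_add act_sections)

lemma avg_scale: "s \<in> sections \<Longrightarrow> avg (sect_scale c s) = sect_scale c (avg s)"
proof -
  assume s: "s \<in> sections"
  have "(\<Sum>g\<in>G. act_sect g (Psi X lam (act_sect (matrix_inv g) (sect_scale c s))))
      = (\<Sum>g\<in>G. sect_scale c (act_sect g (Psi X lam (act_sect (matrix_inv g) s))))"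
    using s by (intro sum.cong refl) (simp only: act_sect_scale Psi_scale act_sections)
  then show ?thesis
    unfolding avg_def by (simp only: sect.scale_sum_right[symmetric] sect.scale_left_commute)
qed

text \<open>Replacing g by h^-1 g permutes the group and moves \<open>h\<close> from the argument to
  the outside.\<close>

lemma avg_equivariant:
  assumes "h \<in> G"
  shows "avg (act_sect h s) = act_sect h (avg s)"
proof -
  have h: "h \<in> SU2" "matrix_inv h \<in> SU2" "matrix_inv h \<in> G"
    using assms G_SU2 matrix_inv_in_SU2 G_icosa_inverse by auto
  have "(\<Sum>g\<in>G. act_sect g (Psi X lam (act_sect (matrix_inv g) (act_sect h s))))
      = (\<Sum>g\<in>G. act_sect h (act_sect g (Psi X lam (act_sect (matrix_inv g) s))))"
  proof (rule sum.reindex_bij_witness[where i = "\<lambda>g. h ** g" and j = "\<lambda>g. matrix_inv h ** g"])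
    fix g assume g: "g \<in> G"
    then have gS: "g \<in> SU2" "matrix_inv g \<in> SU2" using G_SU2 matrix_inv_in_SU2 by auto
    show "h ** (matrix_inv h ** g) = g" "matrix_inv h ** (h ** g) = g"
      by (simp_all add: matrix_mul_assoc SU2_inverse_mult[OF h(1)])
    show "h ** g \<in> G" "matrix_inv h ** g \<in> G"
      using g assms h by (auto intro: G_icosa_mult)
    show "act_sect h (act_sect (matrix_inv h ** g) (Psi X lam (act_sect (matrix_inv (matrix_inv h ** g)) s)))
      = act_sect g (Psi X lam (act_sect (matrix_inv g) (act_sect h s)))"
      by (simp add: act_sect_mult[OF h(2) gS(1)] act_sect_cancel[OF h(1)] matrix_inv_mult_SU2[OF h(2) gS(1)]
          matrix_inv_matrix_inv_SU2[OF h(1)] act_sect_mult[OF gS(2) h(1)])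
  qed
  then show ?thesis
    unfolding avg_def by (simp only: act_sect_scale act_sect_sum)
qed

text \<open>Connects the sum over points g x with the average of conjugates: g^-1 applied to the
  value of \<open>s\<close> at g x is the value at x of the translated section g^-1 s.\<close>

lemma act_lam_eval:
  assumes "g \<in> G"
  shows "act_lam g (lam x) (s (act_line g x)) = act_sect g (lam x (act_sect (matrix_inv g) s x))"
  using assms by (simp add: act_lam_def act_sect_def[of "matrix_inv g" s] matrix_inv_matrix_inv_SU2 G_SU2)

lemma avg_eq:
  "avg s = sect_scale (1 / 120) (\<Sum>g\<in>G. \<Sum>x\<in>X. act_lam g (lam x) (s (act_line g x)))"
  unfolding avg_def Psi_def act_sect_sum
  by (intro arg_cong[of _ _ "sect_scale _"] sum.cong refl) (simp only: act_lam_eval)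

text \<open>The pairs (g, x) are grouped by the point g x. Several pairs may share a point, and the
  inner sum of \<open>orbit_lam\<close> collects exactly these.\<close>

lemma avg_orbit: "avg s = Psi (orbit_points G X) (orbit_lam G X lam) s"
proof -
  define F where "F = (\<lambda>(g, x). act_lam g (lam x) (s (act_line g x)))"
  define h where "h = (\<lambda>(g, x). act_line g x :: (complex^2) set)"
  have fin: "finite (G \<times> X)" using finite_G design_props by simp
  have orb: "orbit_points G X = h ` (G \<times> X)"
    by (auto simp: orbit_points_def h_def)
  have "Psi (orbit_points G X) (orbit_lam G X lam) s
    = (\<Sum>y\<in>orbit_points G X. sect_scale (1 / 120) (\<Sum>(g, x)\<in>{(g, x). g \<in> G \<and> x \<in> X \<and> act_line g x = y}. act_lam g (lam x) (s y)))"
    by (simp add: Psi_def orbit_lam_def card_G_icosa)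
  also have "\<dots> = (\<Sum>y\<in>orbit_points G X. sect_scale (1 / 120) (\<Sum>z\<in>{z \<in> G \<times> X. h z = y}. F z))"
    by (intro sum.cong refl arg_cong[of _ _ "sect_scale _"]) (auto simp: F_def h_def)
  also have "\<dots> = sect_scale (1 / 120) (\<Sum>y\<in>h ` (G \<times> X). \<Sum>z\<in>{z \<in> G \<times> X. h z = y}. F z)"
    by (simp only: sect.scale_sum_right orb)
  also have "(\<Sum>y\<in>h ` (G \<times> X). \<Sum>z\<in>{z \<in> G \<times> X. h z = y}. F z) = (\<Sum>z\<in>G \<times> X. F z)"
    using sum.image_gen[OF fin, of F h] by simp
  also have "\<dots> = (\<Sum>g\<in>G. \<Sum>x\<in>X. act_lam g (lam x) (s (act_line g x)))"
    by (simp only: sum.cartesian_product F_def)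
  finally show ?thesis by (simp only: avg_eq)
qed

lemma orbit_design_data: "design_data (orbit_points G X) (orbit_lam G X lam)"
proof -
  have term_Gamma: "act_lam g (lam x) z \<in> Gamma_comp 2"
    and term_add: "z' \<in> act_line g x \<Longrightarrow> act_lam g (lam x) (z + z') = act_lam g (lam x) z + act_lam g (lam x) z'"
    and term_scale: "act_lam g (lam x) (c *s z) = sect_scale c (act_lam g (lam x) z)"
    if "g \<in> G" "x \<in> X" "z \<in> act_line g x" for g x z z' c
  proof -
    \<comment> \<open>\<open>lam x\<close> is known to be linear only on the line \<open>x\<close>,
      so arguments in g x must first be carried back to it.\<close>
    have *: "matrix_inv g *v u \<in> x" if "u \<in> act_line g x" for u
      using that \<open>g \<in> G\<close>
      by (auto simp: act_line_def matrix_vector_mul_assoc SU2_inverse_mult[OF G_SU2])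
    show "act_lam g (lam x) z \<in> Gamma_comp 2"
      unfolding act_lam_def using that * by (intro act_sect_Gamma_comp design_props(3) G_SU2)
    show "act_lam g (lam x) (z + z') = act_lam g (lam x) z + act_lam g (lam x) z'" if "z' \<in> act_line g x"
      unfolding act_lam_def using that * \<open>x \<in> X\<close> \<open>z \<in> act_line g x\<close>
      by (simp only: matrix_vector_right_distrib design_props(4) act_sect_add)
    show "act_lam g (lam x) (c *s z) = sect_scale c (act_lam g (lam x) z)"
      unfolding act_lam_def using * \<open>x \<in> X\<close> \<open>z \<in> act_line g x\<close>
      by (simp only: matrix_vector_mult_scale design_props(5) act_sect_scale)
  qed
  define I where "I y = {(g, x). g \<in> G \<and> x \<in> X \<and> act_line g x = y}" for y
  have lam_eq: "orbit_lam G X lam y z = sect_scale (1 / of_nat (card G)) (\<Sum>i\<in>I y. act_lam (fst i) (lam (snd i)) z)" for y z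
    unfolding orbit_lam_def I_def
    by (intro arg_cong[of _ _ "sect_scale _"] sum.cong refl) (simp only: case_prod_beta)
  have I: "fst i \<in> G" "snd i \<in> X" "act_line (fst i) (snd i) = y" if "i \<in> I y" for i y
    using that by (auto simp: I_def)
  have "linear_betw (*s) sect_scale y (Gamma_comp 2) (orbit_lam G X lam y)" for y
    unfolding linear_betw_def
  proof (intro conjI ballI allI Pi_I)
    fix u v c assume u: "u \<in> y"
    show "orbit_lam G X lam y u \<in> Gamma_comp 2"
      unfolding lam_eq using u I
      by (intro sect.subspace_scale sect.subspace_sum Gamma_comp_subspace term_Gamma) auto
    have "(\<Sum>i\<in>I y. act_lam (fst i) (lam (snd i)) (c *s u)) = (\<Sum>i\<in>I y. sect_scale c (act_lam (fst i) (lam (snd i)) u))"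
      using u I by (intro sum.cong refl term_scale) auto
    then show "orbit_lam G X lam y (c *s u) = sect_scale c (orbit_lam G X lam y u)"
      unfolding lam_eq by (simp only: sect.scale_sum_right[symmetric] sect.scale_left_commute)
    assume v: "v \<in> y"
    have "(\<Sum>i\<in>I y. act_lam (fst i) (lam (snd i)) (u + v)) 
      = (\<Sum>i\<in>I y. act_lam (fst i) (lam (snd i)) u + act_lam (fst i) (lam (snd i)) v)"
      using u v I by (intro sum.cong refl term_add) auto
    then show "orbit_lam G X lam y (u + v) = orbit_lam G X lam y u + orbit_lam G X lam y v"
      unfolding lam_eq by (simp only: sum.distrib sect.scale_right_distrib)
  qed
  moreover have "orbit_points G X = (\<lambda>(g, x). act_line g x) ` (G \<times> X)"
    by (auto simp: orbit_points_def)
  then have "finite (orbit_points G X)" using finite_G design_props(1) by simp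
  moreover have "orbit_points G X \<subseteq> CP1"
    using design_props(2) by (auto simp: orbit_points_def act_line_in_CP1 G_SU2)
  ultimately show ?thesis by (simp add: design_data_def)
qed

end

section \<open>C^2 as coordinate space of the first component\<close>

locale icosa_design_model = icosa_design + model: sym_component 1 "Gamma_comp 2" \<phi> for \<phi>
begin

definition linear_form :: "complex^2 \<Rightarrow> complex^2 \<Rightarrow> complex" where
  "linear_form v = (\<lambda>\<xi>. v $ 1 * \<xi> $ 1 + v $ 2 * \<xi> $ 2)"

definition embed :: "complex^2 \<Rightarrow> sect" where "embed v = \<phi> (linear_form v)"

text \<open>Meaningful only on \<open>Gamma_comp 2\<close>, the range of \<open>embed\<close>; this
  is why the rules for \<open>coord\<close> ask for membership there.\<close>

definition coord :: "sect \<Rightarrow> complex^2" where "coord = inv_into UNIV embed"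

lemma Sym_power_1: "p \<in> Sym_power 1 \<longleftrightarrow> (\<exists>v. p = linear_form v)"
proof
  assume "p \<in> Sym_power 1"
  then obtain c where "p = (\<lambda>\<xi>. \<Sum>j\<le>1. c j * monom_fun 1 j \<xi>)"
    unfolding Sym_power_iff by blast
  then have "p = linear_form (vector [c 1, c 0])"
    by (simp add: linear_form_def monom_fun_def fun_eq_iff)
  then show "\<exists>v. p = linear_form v" by blast
next
  assume "\<exists>v. p = linear_form v"
  then obtain v where "p = linear_form v" by blast
  then have "p = (\<lambda>\<xi>. \<Sum>j\<le>1. (if j = 1 then v $ 1 else v $ 2) * monom_fun 1 j \<xi>)"
    by (simp add: linear_form_def monom_fun_def fun_eq_iff)
  then show "p \<in> Sym_power 1" unfolding Sym_power_iff by (intro exI)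
qed

lemma linear_form_in: "linear_form v \<in> Sym_power 1"
  unfolding Sym_power_1 by blast

lemma embed_Gamma: "embed v \<in> Gamma_comp 2"
  unfolding embed_def by (intro model.phi_in_W linear_form_in)

lemma embed_sections: "embed v \<in> sections"
  using embed_Gamma Gamma_comp_sections by blast

lemma inj_embed: "inj embed"
proof (rule injI)
  fix v w assume "embed v = embed w"
  then have eq: "linear_form v = linear_form w"
    unfolding embed_def using model.bij linear_form_in by (meson bij_betw_def inj_onD)
  have "linear_form u (axis 1 1) = u $ 1" "linear_form u (axis 2 1) = u $ 2" for u
    by (simp_all add: linear_form_def axis_def)
  then show "v = w" using eq by (metis vec2_eq_iff)
qed

lemma coord_embed: "coord (embed v) = v"
  unfolding coord_def by (rule inv_f_f[OF inj_embed])

lemma embed_coord: "s \<in> Gamma_comp 2 \<Longrightarrow> embed (coord s) = s"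
proof -
  assume "s \<in> Gamma_comp 2"
  then obtain p where "p \<in> Sym_power 1" "s = \<phi> p" by (rule model.W_E)
  then have "s \<in> range embed" unfolding embed_def Sym_power_1 by auto
  then show ?thesis unfolding coord_def by (rule f_inv_into_f)
qed

lemma embed_add: "embed (v + w) = embed v + embed w"
proof -
  have "linear_form (v + w) = linear_form v + linear_form w"
    by (simp add: linear_form_def fun_eq_iff algebra_simps)
  then show ?thesis unfolding embed_def by (simp only: model.phi_add linear_form_in)
qed

lemma embed_scale: "embed (c *s v) = sect_scale c (embed v)"
proof -
  have "linear_form (c *s v) = (\<lambda>\<xi>. c * linear_form v \<xi>)"
    by (simp add: linear_form_def fun_eq_iff algebra_simps)
  then show ?thesis unfolding embed_def by (simp only: model.phi_scale linear_form_in)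
qed

lemma embed_zero: "embed 0 = 0"
  using embed_scale[of 0 0] by (simp only: sect.scale_zero_left vec.scale_zero_left)

lemma embed_sum: "embed (\<Sum>i\<in>A. u i) = (\<Sum>i\<in>A. embed (u i))"
  by (induction A rule: infinite_finite_induct)
    (simp_all only: sum.infinite sum.empty sum.insert embed_zero embed_add not_False_eq_True)

lemma embed_act:
  assumes "g \<in> SU2"
  shows "act_sect g (embed v) = embed (g *v v)"
proof -
  have "act_poly g (linear_form v) = linear_form (g *v v)"
    by (simp add: act_poly_def linear_form_def fun_eq_iff mat2_vec_entry transpose_def algebra_simps)
  then show ?thesis
    unfolding embed_def using model.equiv[OF assms linear_form_in] by metis
qed

lemma coord_add:
  assumes "s \<in> Gamma_comp 2" "t \<in> Gamma_comp 2"
  shows "coord (s + t) = coord s + coord t"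
  by (subst (1 2) embed_coord[OF assms(1), symmetric], subst (1 2) embed_coord[OF assms(2), symmetric])
    (simp only: coord_embed embed_add[symmetric])

lemma coord_scale:
  assumes "s \<in> Gamma_comp 2"
  shows "coord (sect_scale c s) = c *s coord s"
  by (subst (1 2) embed_coord[OF assms(1), symmetric]) (simp only: coord_embed embed_scale[symmetric])

lemma coord_act:
  assumes "s \<in> Gamma_comp 2" "g \<in> SU2"
  shows "coord (act_sect g s) = g *v coord s"
  by (subst (1 2) embed_coord[OF assms(1), symmetric])
    (simp only: coord_embed embed_act[OF assms(2)])

text \<open>Reading the averaged map in coordinates on both sides makes the computations with
  polynomials applicable to it.\<close>

lemma component_equivariant:
  assumes "sym_component n W \<psi>"
  shows "icosa_equivariant \<epsilon> n (\<lambda>p. coord (avg (\<psi> p)))"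
proof -
  interpret c: sym_component n W \<psi> by fact
  have sec: "\<psi> p \<in> sections" if "p \<in> Sym_power n" for p
    using that c.phi_in_W c.sub by blast
  show ?thesis
  proof unfold_locales
    show "linear_betw (\<lambda>c p \<xi>. c * p \<xi>) (*s) (Sym_power n) UNIV (\<lambda>p. coord (avg (\<psi> p)))"
      unfolding linear_betw_def
      by (intro conjI ballI allI Pi_I UNIV_I)
        (simp_all only: c.phi_add c.phi_scale avg_add avg_scale sec coord_add coord_scale avg_Gamma)
    fix g p assume "g \<in> {icosa_S \<epsilon>, icosa_T \<epsilon>, icosa_U}" and p: "p \<in> Sym_power n"
    then have g: "g \<in> G" using G_icosa_generators by blast
    show "coord (avg (\<psi> (act_poly g p))) = g *v coord (avg (\<psi> p))"
      by (simp only: c.equiv[OF G_SU2[OF g] p] avg_equivariant[OF g]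
          coord_act[OF avg_Gamma[OF sec[OF p]] G_SU2[OF g]])
  qed
qed

lemma avg_component_zero:
  assumes "sym_component n W \<psi>" "n \<in> {3, 5, 7, 9}" "s \<in> W"
  shows "avg s = 0"
proof -
  interpret c: sym_component n W \<psi> by fact
  interpret e: icosa_equivariant \<epsilon> n "\<lambda>p. coord (avg (\<psi> p))"
    by (rule component_equivariant) fact
  obtain p where p: "p \<in> Sym_power n" "s = \<psi> p" using assms(3) by (rule c.W_E)
  then have "coord (avg s) = 0" using e.equivariant_3_5_7 e.equivariant_9 assms(2) by auto
  moreover have "avg s \<in> Gamma_comp 2" using assms(3) c.sub by (intro avg_Gamma) blast
  ultimately show ?thesis using embed_coord embed_zero by metis
qed

lemma avg_scalar: "\<exists>c. \<forall>v. avg (embed v) = sect_scale c (embed v)"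
proof -
  interpret e: icosa_equivariant \<epsilon> 1 "\<lambda>p. coord (avg (\<phi> p))"
    by (rule component_equivariant) unfold_locales
  define c where "c = coord (avg (embed (axis 1 1))) $ 1"
  \<comment> \<open>The index of a monomial is the exponent of the first variable, so index 1
    belongs to the first basis vector and index 0 to the second.\<close>
  have "monom_fun 1 1 = linear_form (axis 1 1)" "monom_fun 1 0 = linear_form (axis 2 1)"
    by (simp_all add: monom_fun_def linear_form_def axis_def)
  then have "coord (avg (embed (axis 1 1))) = c *s axis 1 1" "coord (avg (embed (axis 2 1))) = c *s axis 2 1"
    using e.equivariant_1 by (simp_all add: embed_def c_def vec2_eq_iff axis_def)
  then have basis: "avg (embed (axis 1 1)) = sect_scale c (embed (axis 1 1))"
    "avg (embed (axis 2 1)) = sect_scale c (embed (axis 2 1))"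
    using embed_coord[OF avg_Gamma[OF embed_sections]] embed_scale by metis+
  have "avg (embed v) = sect_scale c (embed v)" for v
  proof -
    have v: "v = v $ 1 *s axis 1 1 + v $ 2 *s axis 2 1"
      by (simp add: vec2_eq_iff axis_def)
    have iv: "embed v = sect_scale (v $ 1) (embed (axis 1 1)) + sect_scale (v $ 2) (embed (axis 2 1))"
      by (subst v) (simp only: embed_add embed_scale)
    have "sect_scale (v $ i) (embed w) \<in> sections" for i w
      using sections_subspace embed_sections by (intro sect.subspace_scale)
    then show ?thesis
      unfolding iv
      by (simp only: avg_add avg_scale embed_sections basis sect.scale_right_distrib sect.scale_left_commute)
  qed
  then show ?thesis by blast
qed

definition A :: "complex^2^2" where
  "A = (\<chi> i j. coord (Psi X lam (embed (axis j 1))) $ i)"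

lemma Psi_embed: "Psi X lam (embed v) = embed (A *v v)"
proof -
  let ?P = "\<lambda>v. coord (Psi X lam (embed v))"
  have v: "v = v $ 1 *s axis 1 1 + v $ 2 *s axis 2 1"
    by (simp add: vec2_eq_iff axis_def)
  have iv: "embed v = sect_scale (v $ 1) (embed (axis 1 1)) + sect_scale (v $ 2) (embed (axis 2 1))"
    by (subst v) (simp only: embed_add embed_scale)
  have sec: "sect_scale (v $ i) (embed w) \<in> sections" for i w
    using sections_subspace embed_sections by (intro sect.subspace_scale)
  have gam: "sect_scale (v $ i) (Psi X lam (embed w)) \<in> Gamma_comp 2" for i w
    by (intro sect.subspace_scale Gamma_comp_subspace Psi_Gamma embed_sections)
  have "?P v = v $ 1 *s ?P (axis 1 1) + v $ 2 *s ?P (axis 2 1)"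
    unfolding iv
    by (simp only: Psi_add sec Psi_scale embed_sections coord_add coord_scale gam Psi_Gamma)
  then have "?P v = A *v v"
    by (simp add: vec2_eq_iff mat2_vec_entry A_def mult.commute)
  then show ?thesis
    using embed_coord[OF Psi_Gamma[OF embed_sections]] by metis
qed

text \<open>\<open>Psi X lam\<close> takes values in the plane \<open>Gamma_comp 2\<close>, so on
  \<open>H_space\<close> it has the rank-two form, with the embedded basis vectors and the
  coordinates of its values. Its trace is therefore that of its restriction to the plane, whose
  matrix is \<open>A\<close>.\<close>

lemma trace_A:
  assumes "sect_trace H_space (Psi X lam) = 2"
  shows "trace A = 2"
proof -
  have Gamma_H: "Gamma_comp 2 \<subseteq> H_space"
    unfolding H_space_def using sect.span_superset by force
  have "sect_trace H_space (Psi X lam)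
      = coord (Psi X lam (embed (axis 1 1))) $ 1 + coord (Psi X lam (embed (axis 2 1))) $ 2"
  proof (rule sect_trace_rank_two[where ?L1.0 = "\<lambda>s. coord (Psi X lam s) $ 1"
        and ?L2.0 = "\<lambda>s. coord (Psi X lam s) $ 2"])
    show "sect.subspace H_space" by (simp add: H_space_def)
    show "embed (axis 1 1) \<in> H_space" "embed (axis 2 1) \<in> H_space"
      using embed_Gamma Gamma_H by blast+
    fix s assume "s \<in> H_space"
    then have "Psi X lam s \<in> Gamma_comp 2" using H_space_sections by (intro Psi_Gamma) blast
    then have "Psi X lam s = embed (coord (Psi X lam s))" by (simp only: embed_coord)
    moreover have "v = v $ 1 *s axis 1 1 + v $ 2 *s axis 2 1" for v :: "complex^2"
      by (simp add: vec2_eq_iff axis_def)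
    ultimately show "Psi X lam s = sect_scale (coord (Psi X lam s) $ 1) (embed (axis 1 1))
        + sect_scale (coord (Psi X lam s) $ 2) (embed (axis 2 1))"
      by (metis embed_add embed_scale)
  qed (use assms H_space_sections in \<open>simp_all add: Psi_add Psi_scale coord_add coord_scale Psi_Gamma\<close>)
  then show ?thesis using assms by (simp add: trace_def A_def sum_2)
qed

lemma avg_embed: "avg (embed v) = embed ((1 / 120) *s (\<Sum>g\<in>G. (g ** A ** matrix_inv g) *v v))"
proof -
  have "(\<Sum>g\<in>G. act_sect g (Psi X lam (act_sect (matrix_inv g) (embed v))))
      = (\<Sum>g\<in>G. embed ((g ** A ** matrix_inv g) *v v))"
    by (intro sum.cong refl)
      (simp only: embed_act G_SU2 matrix_inv_in_SU2 Psi_embed matrix_vector_mul_assoc matrix_mul_assoc)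
  then show ?thesis
    unfolding avg_def by (simp only: embed_sum embed_scale)
qed

text \<open>Conjugates of \<open>A\<close> all have trace 2, and their normalized sum is the scalar
  matrix \<open>c\<close>, of trace 2c. The order of the group enters here: m elements would give c
  = m/120.\<close>

lemma avg_identity:
  assumes "sect_trace H_space (Psi X lam) = 2" "s \<in> Gamma_comp 2"
  shows "avg s = s"
proof -
  obtain c where c: "\<And>v. avg (embed v) = sect_scale c (embed v)" using avg_scalar by blast
  have N: "(1 / 120) *s (\<Sum>g\<in>G. (g ** A ** matrix_inv g) *v v) = c *s v" for v
  proof (rule injD[OF inj_embed])
    show "embed ((1 / 120) *s (\<Sum>g\<in>G. (g ** A ** matrix_inv g) *v v)) = embed (c *s v)"
      unfolding avg_embed[symmetric] by (simp only: c embed_scale)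
  qed
  have tr: "trace (g ** A ** matrix_inv g) = 2" if "g \<in> G" for g
  proof -
    have "trace (g ** A ** matrix_inv g) = trace (matrix_inv g ** g ** A)"
      by (simp add: trace_mul_sym[of "g ** A"] matrix_mul_assoc)
    then show ?thesis
      using trace_A[OF assms(1)] by (simp add: SU2_inverse_mult[OF G_SU2[OF that]])
  qed
  have diag: "(M *v axis i 1) $ i = M $ i $ i" for M :: "complex^2^2" and i
    using exhaust_2[of i] by (auto simp: mat2_vec_entry axis_def)
  have "c = (1 / 120) * (\<Sum>g\<in>G. (g ** A ** matrix_inv g) $ i $ i)" for i
    using arg_cong[OF N[of "axis i 1"], of "\<lambda>v. v $ i"] by (simp add: diag)
  from this[of 1] this[of 2] have "2 * c = (1 / 120) * (\<Sum>g\<in>G. trace (g ** A ** matrix_inv g))"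
    by (simp add: trace_def sum_2 sum.distrib mult.commute)
  also have "\<dots> = 2" using tr card_G_icosa by simp
  finally have "c = 1" by simp
  then show ?thesis
    using c[of "coord s"] embed_coord[OF assms(2)] by (simp only: sect.scale_one)
qed

end

section \<open>The orbit sum is a design for the projection\<close>

theorem mainTheorem3:
  fixes \<epsilon> :: complex
    and X :: "(complex^2) set set"
    and lam :: "(complex^2) set \<Rightarrow> complex^2 \<Rightarrow> sect"
    and Psi_Y :: "sect \<Rightarrow> sect"
  assumes "primitive_root_of_unity 5 \<epsilon>"
    and "design_data X lam"
    and "sect_trace H_space (Psi X lam) = 2"
    and "\<And>s. Psi_Y s = sect_scale (1 / 120)
      (\<Sum>g\<in>G_icosa \<epsilon>. \<Sum>x\<in>X. act_lam g (lam x) (s (act_line g x)))"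
  shows "(\<forall>s\<in>H_space. Psi_Y s =
        Psi (orbit_points (G_icosa \<epsilon>) X) (orbit_lam (G_icosa \<epsilon>) X lam) s)
    \<and> tau_design (orbit_points (G_icosa \<epsilon>) X) (orbit_lam (G_icosa \<epsilon>) X lam)
    \<and> (\<forall>s\<in>H_space. Psi_Y s = tau s)
    \<and> (\<forall>k\<in>{1..5}. \<forall>s\<in>Gamma_comp (2 * k). Psi_Y s = (if k = 1 then s else 0))"
proof -
  interpret icosa_design \<epsilon> X lam
    using assms(1,2) by unfold_locales
  have PsiY: "Psi_Y s = avg s" for s
    unfolding assms(4) avg_eq ..
  \<comment> \<open>Otherwise \<open>Psi X lam\<close> would vanish on \<open>H_space\<close>, and
    the trace formula with zero functionals and zero vectors would give 0 instead of 2.\<close>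
  have "Gamma_comp 2 \<noteq> {0}"
  proof
    assume G0: "Gamma_comp 2 = {0}"
    have H0: "(0::sect) \<in> H_space" unfolding H_space_def by (rule sect.span_zero)
    have "sect_trace H_space (Psi X lam) = 0 + 0"
    proof (rule sect_trace_rank_two[OF _ H_space_sections H0 H0])
      show "sect.subspace H_space" by (simp add: H_space_def)
      fix s assume "s \<in> H_space"
      then have "Psi X lam s \<in> {0}" unfolding G0[symmetric] using H_space_sections by (intro Psi_Gamma) blast
      then show "Psi X lam s = sect_scale 0 0 + sect_scale 0 0"
        by (simp only: singleton_iff sect.scale_zero_left add_0)
    qed (use assms(3) in simp_all)
    then show False using assms(3) by simp
  qed
  then obtain \<phi> where "sym_component 1 (Gamma_comp 2) \<phi>"
    using Gamma_comp_cases[of 1] by auto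
  then interpret icosa_design_model \<epsilon> X lam \<phi>
    by (rule icosa_design_model.intro[OF icosa_design_axioms])
  let ?R = "sect.span (\<Union>k\<in>{2..5}. Gamma_comp (2 * k))"
  have on_Gamma: "avg s = (if k = 1 then s else 0)" if k: "k \<in> {1..5}" and s: "s \<in> Gamma_comp (2 * k)" for k s
  proof (cases "k = 1")
    case True
    then show ?thesis using avg_identity[OF assms(3)] s by simp
  next
    case False
    have zero: "avg 0 = 0"
      using avg_scale[OF sect.subspace_0[OF sections_subspace], of 0] by (simp only: sect.scale_zero_left)
    from k have "1 \<le> k" by simp
    \<comment> \<open>The component may be {0} as far as is known here, and then \<open>s\<close> is
      zero; otherwise it is a copy of S^(2k-1), and k = 2, ..., 5 gives the degrees 3, 5, 7,
      9.\<close>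
    then have "avg s = 0"
    proof (cases rule: Gamma_comp_cases)
      case 1
      then show ?thesis using s zero by auto
    next
      case (2 \<psi>)
      have "k \<in> {2, 3, 4, 5}" using k False by auto
      then show ?thesis using avg_component_zero[OF 2 _ s] by auto
    qed
    then show ?thesis using False by simp
  qed
  have R_sections: "?R \<subseteq> sections"
    using Gamma_comp_sections by (intro sect.span_minimal sections_subspace) blast
  have on_R: "avg s = 0" if "s \<in> ?R" for s
  proof -
    \<comment> \<open>Linearity of \<open>avg\<close> is available on \<open>sections\<close>, so
      its kernel is formed inside that space.\<close>
    have "sect.subspace {s \<in> sections. avg s = 0}"
      unfolding sect.subspace_def
    proof (intro conjI ballI allI)
      show "0 \<in> {s \<in> sections. avg s = 0}"
        using avg_scale[OF sect.subspace_0[OF sections_subspace], of 0] sect.subspace_0[OF sections_subspace]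
        by (simp only: sect.scale_zero_left mem_Collect_eq simp_thms)
      fix s t c assume s: "s \<in> {s \<in> sections. avg s = 0}"
      then show "sect_scale c s \<in> {s \<in> sections. avg s = 0}"
        using sect.subspace_scale[OF sections_subspace] 
        by (simp only: mem_Collect_eq avg_scale sect.scale_zero_right simp_thms)
      assume "t \<in> {s \<in> sections. avg s = 0}"
      then show "s + t \<in> {s \<in> sections. avg s = 0}"
        using s sect.subspace_add[OF sections_subspace]
        by (simp only: mem_Collect_eq avg_add add_0 simp_thms)
    qed
    moreover have "(\<Union>k\<in>{2..5}. Gamma_comp (2 * k)) \<subseteq> {s \<in> sections. avg s = 0}"
    proof (intro UN_least subsetI CollectI conjI)
      fix k s assume k: "k \<in> {2..5}" and s: "s \<in> Gamma_comp (2 * k)"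
      show "s \<in> sections" using s Gamma_comp_sections by blast
      from k have "k \<in> {1..5}" "k \<noteq> 1" by auto
      then show "avg s = 0" by (simp only: on_Gamma[OF _ s] if_False)
    qed
    ultimately have "?R \<subseteq> {s \<in> sections. avg s = 0}" by (intro sect.span_minimal)
    then show ?thesis using that by blast
  qed
  have tau: "tau s = avg s" if s: "s \<in> H_space" for s
    unfolding tau_def
  proof (rule the_equality)
    have "{1..5} = insert 1 {2..5::nat}" by auto
    then have "(\<Union>k\<in>{1..5}. Gamma_comp (2 * k)) = Gamma_comp 2 \<union> (\<Union>k\<in>{2..5}. Gamma_comp (2 * k))"
      by simp
    then have "s \<in> sect.span (Gamma_comp 2 \<union> (\<Union>k\<in>{2..5}. Gamma_comp (2 * k)))"
      using s by (simp only: H_space_def)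
    then obtain u r where "s = u + r" "u \<in> sect.span (Gamma_comp 2)" and r: "r \<in> ?R"
      unfolding sect.span_Un by blast
    then have u: "u \<in> Gamma_comp 2" "s - u = r"
      using Gamma_comp_subspace by (simp_all only: sect.span_eq_iff[THEN iffD2] add_diff_cancel_left')
    \<comment> \<open>Applying \<open>avg\<close> to s = u' + (s - u') returns u', as it fixes the
      first term and kills the second. This takes the place of a proof that the sum is
      direct.\<close>
    have unique: "u' = avg s" if u': "u' \<in> Gamma_comp 2" "s - u' \<in> ?R" for u'
    proof -
      have "avg (u' + (s - u')) = avg u' + avg (s - u')"
        using u' R_sections Gamma_comp_sections by (intro avg_add) blast+
      also have "\<dots> = u'"
        using avg_identity[OF assms(3) u'(1)] on_R[OF u'(2)] by (simp only: add_0_right)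
      finally have "avg (u' + (s - u')) = u'" .
      moreover have "u' + (s - u') = s" by (subst add.commute) (rule diff_add_cancel)
      ultimately show ?thesis by (simp only:)
    qed
    \<comment> \<open>The spans supply some component \<open>u\<close>; uniqueness identifies it
      with \<open>avg s\<close>, so \<open>avg s\<close> itself satisfies the description.\<close>
    have "u = avg s" using u r by (intro unique) (simp_all only:)
    then show "avg s \<in> Gamma_comp 2 \<and> s - avg s \<in> ?R" using u r by (simp only: simp_thms)
    show "u' = avg s" if "u' \<in> Gamma_comp 2 \<and> s - u' \<in> ?R" for u'
      using unique that by blast
  qed
  have "tau_design (orbit_points G X) (orbit_lam G X lam)"
    unfolding tau_design_def
    using orbit_design_data tau avg_orbit by metis
  then show ?thesis
    using PsiY avg_orbit tau on_Gamma by metis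
qed

end
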